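(* For all $a^{(k)}\in\Lambda^k(\Omega)$ the following commutation relations hold: $$\pi_h^\star\,\star a^{(k)}=\star\,\tilde\pi_h\,a^{(k)}\qquad\text{and}\qquad \star\,\pi_h^\star\,a^{(k)}=\tilde\pi_h\,\star a^{(k)},$$ where $\pi_h^\star$ is the canonical coprojection and $\tilde\pi_h$ is the projection associated with the dual cell complex.
   Context: $\Omega$ is an $n$-dimensional oriented Riemannian manifold and $\Lambda^k(\Omega)$ its space of differential $k$-forms. $\star:\Lambda^k(\Omega)\to\Lambda^{n-k}(\Omega)$ is the Hodge star, defined by $a^{(k)}\wedge\star b^{(k)}=(a^{(k)},b^{(k)})\,w^{(n)}$ with $w^{(n)}$ the standard volume form, so that $\star\star=(-1)^{k(n-k)}$ on $k$-forms. $D$ is a cell complex covering $\Omega$, $\tilde D$ its dual cell complex (each $k$-cell of $D$ corresponds to a dual $(n-k)$-cell), and $D_i,\tilde D_i$ are their interior parts, $\tilde D_i$ being the collection of dual cells of the cells of $D_i$. $C^j(\tilde D_i)$ denotes the $j$-cochains (real linear functionals on $j$-chains). For every degree $j$, $\tilde{\mathcal R}:\Lambda^j(\Omega)\to C^j(\tilde D_i)$ is the reduction $\langle\tilde{\mathcal R}a,c\rangle=\int_ca$, and $\tilde{\mathcal I}:C^j(\tilde D_i)\to\Lambda^j(\Omega)$ is a linear reconstruction with $\tilde{\mathcal R}\tilde{\mathcal I}=\mathrm{Id}$. $\tilde\pi_h:=\tilde{\mathcal I}\circ\tilde{\mathcal R}$. The canonical coprojection on $k$-forms is $\pi_h^\star:=(-1)^{k(n-k)}\star\tilde\pi_h\star$.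 *)

theory Defs
  imports "HOL-Analysis.Analysis" "HOL-Combinatorics.Permutations"
begin

section \<open>Smooth maps\<close>

primrec Ck_on :: "nat \<Rightarrow> 'e::real_normed_vector set \<Rightarrow> ('e \<Rightarrow> 'f::real_normed_vector) \<Rightarrow> bool" where
  "Ck_on 0 W f \<longleftrightarrow> continuous_on W f"
| "Ck_on (Suc k) W f \<longleftrightarrow>
     (\<forall>x\<in>W. f differentiable (at x)) \<and> (\<forall>v. Ck_on k W (\<lambda>x. frechet_derivative f (at x) v))"

text \<open>On a set that need not be open, smooth means: locally the restriction of a smooth map
  that is defined on an open set.\<close>

definition smooth_on :: "'e::real_normed_vector set \<Rightarrow> ('e \<Rightarrow> 'f::real_normed_vector) \<Rightarrow> bool" where
  "smooth_on S f \<longleftrightarrow>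
     (\<forall>x\<in>S. \<exists>W h. open W \<and> x \<in> W \<and> (\<forall>k. Ck_on k W h) \<and> (\<forall>y\<in>W \<inter> S. h y = f y))"


section \<open>Oriented Riemannian manifolds\<close>

type_synonym ('a, 'n) chart = "'a set \<times> ('a \<Rightarrow> real ^ 'n)"

text \<open>A tangent vector at \<open>p\<close> is given by its component vectors in all the charts around \<open>p\<close>,
  which have to be related by the Jacobians of the chart transitions; it is \<open>0\<close> at all other
  charts.\<close>

type_synonym ('a, 'n) tvec = "('a, 'n) chart \<Rightarrow> real ^ 'n"

text \<open>The dimension is \<open>CARD('n)\<close>. The field \<open>num\<close> numbers the coordinates of \<open>real ^ 'n\<close> by
  \<open>0, \<dots>, CARD('n) - 1\<close>; this is needed to speak about the sign of an ordered basis.\<close>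

record ('a, 'n::finite) rmanifold =
  pts :: "'a topology"
  atlas :: "('a, 'n) chart set"
  num :: "'n \<Rightarrow> nat"
  metric :: "'a \<Rightarrow> ('a, 'n) tvec \<Rightarrow> ('a, 'n) tvec \<Rightarrow> real"

abbreviation mdim :: "('a, 'n::finite) rmanifold \<Rightarrow> nat" where
  "mdim M \<equiv> CARD('n)"

text \<open>The model spaces are the sectors cut out by linearly independent linear forms:
  \<open>B = {}\<close> gives the whole space and a singleton \<open>B\<close> a half-space. So manifolds without boundary,
  with boundary, and with corners are covered. The normals in \<open>B\<close> are not restricted to be basis
  vectors, so that oriented atlases exist in dimension one as well.\<close>

definition is_chart :: "'a topology \<Rightarrow> ('a, 'n::finite) chart \<Rightarrow> bool" where
  "is_chart X \<phi> \<longleftrightarrow>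
     openin X (fst \<phi>) \<and>
     homeomorphic_map (subtopology X (fst \<phi>)) (top_of_set (snd \<phi> ` fst \<phi>)) (snd \<phi>) \<and>
     (\<exists>B. independent B \<and> openin (top_of_set {x. \<forall>u\<in>B. 0 \<le> u \<bullet> x}) (snd \<phi> ` fst \<phi>))"

definition chart_inv :: "('a, 'n) chart \<Rightarrow> real ^ 'n \<Rightarrow> 'a" where
  "chart_inv \<phi> = inv_into (fst \<phi>) (snd \<phi>)"

definition overlap :: "('a, 'n) chart \<Rightarrow> ('a, 'n) chart \<Rightarrow> (real ^ 'n) set" where
  "overlap \<phi> \<psi> = snd \<phi> ` (fst \<phi> \<inter> fst \<psi>)"

definition transition :: "('a, 'n) chart \<Rightarrow> ('a, 'n) chart \<Rightarrow> real ^ 'n \<Rightarrow> real ^ 'n" where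
  "transition \<phi> \<psi> = snd \<psi> \<circ> chart_inv \<phi>"

text \<open>The derivative is taken within the overlap because of boundary points.\<close>

definition jac :: "('a, 'n::finite) chart \<Rightarrow> ('a, 'n) chart \<Rightarrow> 'a \<Rightarrow> real ^ 'n \<Rightarrow> real ^ 'n" where
  "jac \<phi> \<psi> p = frechet_derivative (transition \<phi> \<psi>) (at (snd \<phi> p) within overlap \<phi> \<psi>)"

definition charts_at :: "('a, 'n::finite) rmanifold \<Rightarrow> 'a \<Rightarrow> ('a, 'n) chart set" where
  "charts_at M p = {\<phi> \<in> atlas M. p \<in> fst \<phi>}"

definition tangent_space :: "('a, 'n::finite) rmanifold \<Rightarrow> 'a \<Rightarrow> ('a, 'n) tvec set" where
  "tangent_space M p =
     {X. (\<forall>\<phi>\<in>charts_at M p. \<forall>\<psi>\<in>charts_at M p. X \<psi> = jac \<phi> \<psi> p (X \<phi>)) \<and>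
         (\<forall>\<phi>. \<phi> \<notin> charts_at M p \<longrightarrow> X \<phi> = 0)}"

definition tvec_of :: "('a, 'n::finite) rmanifold \<Rightarrow> ('a, 'n) chart \<Rightarrow> 'a \<Rightarrow> real ^ 'n \<Rightarrow> ('a, 'n) tvec" where
  "tvec_of M \<phi> p u = (\<lambda>\<psi>. if \<psi> \<in> charts_at M p then jac \<phi> \<psi> p u else 0)"

definition oriented_manifold :: "('a, 'n::finite) rmanifold \<Rightarrow> bool" where
  "oriented_manifold M \<longleftrightarrow>
     Hausdorff_space (pts M) \<and> second_countable (pts M) \<and>
     bij_betw (num M) UNIV {..<mdim M} \<and>
     (\<forall>\<phi>\<in>atlas M. is_chart (pts M) \<phi>) \<and>
     (\<Union>\<phi>\<in>atlas M. fst \<phi>) = topspace (pts M) \<and>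
     (\<forall>\<phi>\<in>atlas M. \<forall>\<psi>\<in>atlas M. smooth_on (overlap \<phi> \<psi>) (transition \<phi> \<psi>)) \<and>
     (\<forall>\<phi>\<in>atlas M. \<forall>\<psi>\<in>atlas M. \<forall>p\<in>fst \<phi> \<inter> fst \<psi>. 0 < det (matrix (jac \<phi> \<psi> p)))"

definition riemannian_metric :: "('a, 'n::finite) rmanifold \<Rightarrow> bool" where
  "riemannian_metric M \<longleftrightarrow>
     (\<forall>p\<in>topspace (pts M).
        (\<forall>X\<in>tangent_space M p. \<forall>Y\<in>tangent_space M p. metric M p X Y = metric M p Y X) \<and>
        (\<forall>X\<in>tangent_space M p. \<forall>Y\<in>tangent_space M p. \<forall>Z\<in>tangent_space M p. \<forall>c.
           metric M p (\<lambda>\<phi>. c *\<^sub>R X \<phi> + Y \<phi>) Z = c * metric M p X Z + metric M p Y Z) \<and>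
        (\<forall>X\<in>tangent_space M p. X \<noteq> (\<lambda>_. 0) \<longrightarrow> 0 < metric M p X X)) \<and>
     (\<forall>\<phi>\<in>atlas M. \<forall>u w. smooth_on (snd \<phi> ` fst \<phi>)
        (\<lambda>x. metric M (chart_inv \<phi> x) (tvec_of M \<phi> (chart_inv \<phi> x) u) (tvec_of M \<phi> (chart_inv \<phi> x) w)))"

definition oriented_riemannian_manifold :: "('a, 'n::finite) rmanifold \<Rightarrow> bool" where
  "oriented_riemannian_manifold M \<longleftrightarrow> oriented_manifold M \<and> riemannian_metric M"

definition boundary_pts :: "('a, 'n::finite) rmanifold \<Rightarrow> 'a set" where
  "boundary_pts M = {p. \<exists>\<phi>\<in>charts_at M p. snd \<phi> p \<notin> interior (snd \<phi> ` fst \<phi>)}"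


section \<open>Differential forms\<close>

text \<open>Alternating \<open>k\<close>-linear forms on a space \<open>V\<close> of tangent vectors. The arguments are
  \<open>v 0, \<dots>, v (k - 1)\<close>; the last two conditions make equality of forms the equality as functions on
  \<open>V\<^sup>k\<close>.\<close>

definition alt_forms ::
    "nat \<Rightarrow> ('a, 'n::finite) tvec set \<Rightarrow> ((nat \<Rightarrow> ('a, 'n) tvec) \<Rightarrow> real) set" where
  "alt_forms k V =
     {\<omega>. (\<forall>v. (\<forall>i<k. v i \<in> V) \<longrightarrow>
             (\<forall>i<k. \<forall>X\<in>V. \<forall>Y\<in>V. \<forall>c.
                \<omega> (v(i := \<lambda>\<phi>. c *\<^sub>R X \<phi> + Y \<phi>)) = c * \<omega> (v(i := X)) + \<omega> (v(i := Y))) \<and>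
             (\<forall>i<k. \<forall>j<k. i \<noteq> j \<and> v i = v j \<longrightarrow> \<omega> v = 0)) \<and>
         (\<forall>v w. (\<forall>i<k. v i = w i) \<longrightarrow> \<omega> v = \<omega> w) \<and>
         (\<forall>v. \<not> (\<forall>i<k. v i \<in> V) \<longrightarrow> \<omega> v = 0)}"

definition wedge ::
    "nat \<Rightarrow> nat \<Rightarrow> ((nat \<Rightarrow> 'v) \<Rightarrow> real) \<Rightarrow> ((nat \<Rightarrow> 'v) \<Rightarrow> real) \<Rightarrow> (nat \<Rightarrow> 'v) \<Rightarrow> real" where
  "wedge k l \<alpha> \<beta> = (\<lambda>v. (\<Sum>\<sigma> | \<sigma> permutes {..<k + l}.
       of_int (sign \<sigma>) * \<alpha> (\<lambda>i. v (\<sigma> i)) * \<beta> (\<lambda>i. v (\<sigma> (k + i)))) / (fact k * fact l))"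

type_synonym ('a, 'n) form = "'a \<Rightarrow> (nat \<Rightarrow> ('a, 'n) tvec) \<Rightarrow> real"

definition forms :: "('a, 'n::finite) rmanifold \<Rightarrow> nat \<Rightarrow> ('a, 'n) form set" where
  "forms M k =
     {a. (\<forall>p\<in>topspace (pts M). a p \<in> alt_forms k (tangent_space M p)) \<and>
         (\<forall>p. p \<notin> topspace (pts M) \<longrightarrow> a p = (\<lambda>_. 0)) \<and>
         (\<forall>\<phi>\<in>atlas M. \<forall>u. smooth_on (snd \<phi> ` fst \<phi>)
            (\<lambda>x. a (chart_inv \<phi> x) (\<lambda>i. tvec_of M \<phi> (chart_inv \<phi> x) (u i))))}"


section \<open>Hodge star\<close>

definition oriented_orthonormal_frame ::
    "('a, 'n::finite) rmanifold \<Rightarrow> 'a \<Rightarrow> (nat \<Rightarrow> ('a, 'n) tvec) \<Rightarrow> bool" where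
  "oriented_orthonormal_frame M p e \<longleftrightarrow>
     (\<forall>i<mdim M. e i \<in> tangent_space M p) \<and>
     (\<forall>i<mdim M. \<forall>j<mdim M. metric M p (e i) (e j) = (if i = j then 1 else 0)) \<and>
     (\<forall>\<phi>\<in>charts_at M p. 0 < det (\<chi> r c. e (num M c) \<phi> $ r))"

text \<open>The inner product and the volume form below do not depend on the choice of the frame.\<close>

definition frame :: "('a, 'n::finite) rmanifold \<Rightarrow> 'a \<Rightarrow> nat \<Rightarrow> ('a, 'n) tvec" where
  "frame M p = (SOME e. oriented_orthonormal_frame M p e)"

text \<open>The induced inner product of \<open>k\<close>-forms,
  \<open>(a, b) = (1 / k!) \<Sum> a(e\<^sub>i\<^sub>1, \<dots>, e\<^sub>i\<^sub>k) b(e\<^sub>i\<^sub>1, \<dots>, e\<^sub>i\<^sub>k)\<close>,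
  i.e. the sum over increasing multi-indices. The wedge products of the dual coframe are
  orthonormal for it.\<close>

definition form_inner ::
    "('a, 'n::finite) rmanifold \<Rightarrow> nat \<Rightarrow> 'a \<Rightarrow> ((nat \<Rightarrow> ('a, 'n) tvec) \<Rightarrow> real) \<Rightarrow>
     ((nat \<Rightarrow> ('a, 'n) tvec) \<Rightarrow> real) \<Rightarrow> real" where
  "form_inner M k p a b =
     (\<Sum>f\<in>{..<k} \<rightarrow>\<^sub>E {..<mdim M}. a (frame M p \<circ> f) * b (frame M p \<circ> f)) / fact k"

text \<open>The standard volume form: the wedge product of the coframe \<open>g(\<cdot>, e\<^sub>i)\<close>, written out as a
  determinant.\<close>

definition vol_form :: "('a, 'n::finite) rmanifold \<Rightarrow> ('a, 'n) form" where
  "vol_form M p v =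
     (if p \<in> topspace (pts M) \<and> (\<forall>i<mdim M. v i \<in> tangent_space M p)
      then \<Sum>\<sigma> | \<sigma> permutes {..<mdim M}.
             of_int (sign \<sigma>) * (\<Prod>i<mdim M. metric M p (v i) (frame M p (\<sigma> i)))
      else 0)"

definition hodge :: "('a, 'n::finite) rmanifold \<Rightarrow> nat \<Rightarrow> ('a, 'n) form \<Rightarrow> ('a, 'n) form" where
  "hodge M k b = (\<lambda>p. if p \<in> topspace (pts M)
     then THE \<eta>. \<eta> \<in> alt_forms (mdim M - k) (tangent_space M p) \<and>
            (\<forall>a\<in>alt_forms k (tangent_space M p).
               wedge k (mdim M - k) a \<eta> = (\<lambda>v. form_inner M k p a (b p) * vol_form M p v))
     else (\<lambda>_. 0))"


section \<open>Cells and integration\<close>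

text \<open>A \<open>k\<close>-cell carries an orientation through its parametrization \<open>cmap\<close>, which is defined on a
  \<open>k\<close>-dimensional compact convex set. Here \<open>\<real>\<^sup>k\<close> is identified with the subspace of \<open>real ^ 'n\<close>
  on which the coordinates numbered \<open>k\<close> and higher vanish.\<close>

record ('a, 'n::finite) cell =
  cdim :: nat
  cdom :: "(real ^ 'n) set"
  cmap :: "real ^ 'n \<Rightarrow> 'a"

definition closed_cell :: "('a, 'n::finite) cell \<Rightarrow> 'a set" where
  "closed_cell \<sigma> = cmap \<sigma> ` cdom \<sigma>"

definition open_cell :: "('a, 'n::finite) cell \<Rightarrow> 'a set" where
  "open_cell \<sigma> = cmap \<sigma> ` rel_interior (cdom \<sigma>)"

definition cell_boundary :: "('a, 'n::finite) cell \<Rightarrow> 'a set" where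
  "cell_boundary \<sigma> = cmap \<sigma> ` rel_frontier (cdom \<sigma>)"

text \<open>The parametrization is a homeomorphism onto the cell and piecewise smooth; pieces are
  admitted because dual cells are often glued from several smooth patches.\<close>

definition is_cell :: "('a, 'n::finite) rmanifold \<Rightarrow> ('a, 'n) cell \<Rightarrow> bool" where
  "is_cell M \<sigma> \<longleftrightarrow>
     cdim \<sigma> \<le> mdim M \<and>
     cdom \<sigma> \<subseteq> {x. \<forall>c. cdim \<sigma> \<le> num M c \<longrightarrow> x $ c = 0} \<and>
     compact (cdom \<sigma>) \<and> convex (cdom \<sigma>) \<and> aff_dim (cdom \<sigma>) = int (cdim \<sigma>) \<and>
     closed_cell \<sigma> \<subseteq> topspace (pts M) \<and>
     homeomorphic_map (top_of_set (cdom \<sigma>)) (subtopology (pts M) (closed_cell \<sigma>)) (cmap \<sigma>) \<and>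
     (\<exists>\<P>. finite \<P> \<and> \<Union>\<P> = cdom \<sigma> \<and>
        (\<forall>P\<in>\<P>. compact P \<and> convex P \<and>
           (\<forall>\<phi>\<in>atlas M. smooth_on {x \<in> P. cmap \<sigma> x \<in> fst \<phi>} (snd \<phi> \<circ> cmap \<sigma>))))"

text \<open>The image of the coordinate vector number \<open>i\<close> under the differential of \<open>cmap\<close> at \<open>x\<close>.\<close>

definition cell_tangent ::
    "('a, 'n::finite) rmanifold \<Rightarrow> ('a, 'n) cell \<Rightarrow> real ^ 'n \<Rightarrow> nat \<Rightarrow> ('a, 'n) tvec" where
  "cell_tangent M \<sigma> x i = (\<lambda>\<phi>. if \<phi> \<in> charts_at M (cmap \<sigma> x)
     then frechet_derivative (snd \<phi> \<circ> cmap \<sigma>)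
            (at x within {y \<in> cdom \<sigma>. cmap \<sigma> y \<in> fst \<phi>}) (\<chi> c. if num M c = i then 1 else 0)
     else 0)"

text \<open>The integral of the pullback over the domain with respect to Lebesgue measure on \<open>\<real>\<^sup>k\<close>. The
  completion is needed because the integrand is arbitrary on the null set where a piecewise smooth
  parametrization is not differentiable.\<close>

definition cell_integral :: "('a, 'n::finite) rmanifold \<Rightarrow> ('a, 'n) cell \<Rightarrow> ('a, 'n) form \<Rightarrow> real" where
  "cell_integral M \<sigma> a =
     (\<integral>y. (let x = (\<chi> c. if num M c < cdim \<sigma> then y (num M c) else 0)
           in indicator (cdom \<sigma>) x * a (cmap \<sigma> x) (cell_tangent M \<sigma> x))
      \<partial>completion (Pi\<^sub>M {..<cdim \<sigma>} (\<lambda>_. lborel)))"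


section \<open>Cell complexes, chains and cochains\<close>

definition cell_complex :: "('a, 'n::finite) rmanifold \<Rightarrow> ('a, 'n) cell set \<Rightarrow> bool" where
  "cell_complex M D \<longleftrightarrow>
     (\<forall>\<sigma>\<in>D. is_cell M \<sigma>) \<and>
     (\<Union>\<sigma>\<in>D. closed_cell \<sigma>) = topspace (pts M) \<and>
     (\<forall>\<sigma>\<in>D. \<forall>\<tau>\<in>D. \<sigma> \<noteq> \<tau> \<longrightarrow> open_cell \<sigma> \<inter> open_cell \<tau> = {}) \<and>
     (\<forall>\<sigma>\<in>D. cell_boundary \<sigma> =
        (\<Union>\<tau>\<in>{\<tau>\<in>D. cdim \<tau> < cdim \<sigma> \<and> closed_cell \<tau> \<subseteq> cell_boundary \<sigma>}. closed_cell \<tau>)) \<and>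
     (\<forall>p\<in>topspace (pts M). \<exists>U. openin (pts M) U \<and> p \<in> U \<and> finite {\<sigma>\<in>D. closed_cell \<sigma> \<inter> U \<noteq> {}})"

text \<open>The map \<open>dual\<close> sends each cell of \<open>D\<close> to its dual cell. The dual complex may need further
  cells on the boundary of the manifold.\<close>

definition dual_cell_complex ::
    "('a, 'n::finite) rmanifold \<Rightarrow> ('a, 'n) cell set \<Rightarrow> ('a, 'n) cell set \<Rightarrow>
     (('a, 'n) cell \<Rightarrow> ('a, 'n) cell) \<Rightarrow> bool" where
  "dual_cell_complex M D D' dual \<longleftrightarrow>
     cell_complex M D' \<and>
     inj_on dual D \<and> dual ` D \<subseteq> D' \<and>
     (\<forall>\<sigma>\<in>D. cdim (dual \<sigma>) = mdim M - cdim \<sigma>) \<and>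
     (\<forall>\<sigma>\<in>D. \<forall>\<tau>\<in>D. closed_cell \<sigma> \<subseteq> closed_cell \<tau> \<longleftrightarrow> closed_cell (dual \<tau>) \<subseteq> closed_cell (dual \<sigma>)) \<and>
     (\<forall>\<tau>\<in>D' - dual ` D. closed_cell \<tau> \<subseteq> boundary_pts M)"

definition interior_cells :: "('a, 'n::finite) rmanifold \<Rightarrow> ('a, 'n) cell set \<Rightarrow> ('a, 'n) cell set" where
  "interior_cells M D = {\<sigma>\<in>D. \<not> closed_cell \<sigma> \<subseteq> boundary_pts M}"

type_synonym ('a, 'n) chain = "('a, 'n) cell \<Rightarrow> real"
type_synonym ('a, 'n) cochain = "('a, 'n) chain \<Rightarrow> real"

definition chains :: "('a, 'n::finite) cell set \<Rightarrow> nat \<Rightarrow> ('a, 'n) chain set" where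
  "chains K j = {c. finite {\<sigma>. c \<sigma> \<noteq> 0} \<and> (\<forall>\<sigma>. c \<sigma> \<noteq> 0 \<longrightarrow> \<sigma> \<in> K \<and> cdim \<sigma> = j)}"

definition cochains :: "('a, 'n::finite) cell set \<Rightarrow> nat \<Rightarrow> ('a, 'n) cochain set" where
  "cochains K j =
     {s. (\<forall>c\<in>chains K j. \<forall>d\<in>chains K j. \<forall>r. s (\<lambda>\<sigma>. r * c \<sigma> + d \<sigma>) = r * s c + s d) \<and>
         (\<forall>c. c \<notin> chains K j \<longrightarrow> s c = 0)}"

definition reduction ::
    "('a, 'n::finite) rmanifold \<Rightarrow> ('a, 'n) cell set \<Rightarrow> nat \<Rightarrow> ('a, 'n) form \<Rightarrow> ('a, 'n) cochain" where
  "reduction M K j a =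
     (\<lambda>c. if c \<in> chains K j then \<Sum>\<sigma> | c \<sigma> \<noteq> 0. c \<sigma> * cell_integral M \<sigma> a else 0)"

definition reconstruction ::
    "('a, 'n::finite) rmanifold \<Rightarrow> ('a, 'n) cell set \<Rightarrow>
     (nat \<Rightarrow> ('a, 'n) cochain \<Rightarrow> ('a, 'n) form) \<Rightarrow> bool" where
  "reconstruction M K I \<longleftrightarrow>
     (\<forall>j. (\<forall>s\<in>cochains K j. I j s \<in> forms M j) \<and>
          (\<forall>s\<in>cochains K j. \<forall>t\<in>cochains K j. \<forall>r.
             I j (\<lambda>c. r * s c + t c) = (\<lambda>p v. r * I j s p v + I j t p v)) \<and>
          (\<forall>s\<in>cochains K j. reduction M K j (I j s) = s))"

definition projection ::
    "('a, 'n::finite) rmanifold \<Rightarrow> ('a, 'n) cell set \<Rightarrow>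
     (nat \<Rightarrow> ('a, 'n) cochain \<Rightarrow> ('a, 'n) form) \<Rightarrow> nat \<Rightarrow> ('a, 'n) form \<Rightarrow> ('a, 'n) form" where
  "projection M K I j = I j \<circ> reduction M K j"

definition coprojection ::
    "('a, 'n::finite) rmanifold \<Rightarrow> ('a, 'n) cell set \<Rightarrow>
     (nat \<Rightarrow> ('a, 'n) cochain \<Rightarrow> ('a, 'n) form) \<Rightarrow> nat \<Rightarrow> ('a, 'n) form \<Rightarrow> ('a, 'n) form" where
  "coprojection M K I k a = (\<lambda>p v. (-1) ^ (k * (mdim M - k)) *
     hodge M (mdim M - k) (projection M K I (mdim M - k) (hodge M k a)) p v)"

end

theory Submission
  imports Defs
begin

text \<open>Fix a point and an oriented orthonormal frame \<open>e\<close> there. The star of a \<open>k\<close>-form \<open>b\<close> is the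
  contraction \<open>w \<mapsto> (1 / k!) \<Sum>\<^sub>f b(e\<^sub>f) vol(e\<^sub>f, w)\<close>; counting the multi-indices gives
  \<open>\<star>\<star> = (-1)\<^bsup>k(n-k)\<^esup>\<close>, and \<open>a \<and> c = (\<star>a, c) vol\<close> shows that it is the unique solution of
  the defining equation of \<open>hodge\<close>. Since the projection is linear and \<open>\<star>\<close> is homogeneous, the two
  signs in \<open>\<pi>\<^sup>\<star>\<star>a\<close> and in \<open>\<star>\<pi>\<^sup>\<star>a\<close> cancel. An oriented orthonormal frame exists because the
  derivatives of the chart transitions are unique even at boundary points and corners, so that the
  Jacobians satisfy the cocycle condition and tangent spaces have full dimension.\<close>


section \<open>Alternating forms\<close>

text \<open>Multi-indices are counted only for the double star; the defining equation and its
  uniqueness then follow formally, by adjunction and graded commutativity. Inner products and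
  contractions sum over all index functions, weighted by a factorial, instead of over increasing
  multi-indices. Nothing has to be sorted: functions with a repeated value contribute 0, and
  reorderings of one index set contribute equally because each sign occurs twice. The projection is
  applied to the star of a form, about whose regularity nothing is established. Signs still pass
  through it, because integration over cells is homogeneous for arbitrary integrands.\<close>

locale tvec_space =
  fixes V :: "('a, 'n::finite) tvec set"
  assumes zero_mem: "(\<lambda>_. 0) \<in> V"
    and lincomb_mem: "X \<in> V \<Longrightarrow> Y \<in> V \<Longrightarrow> (\<lambda>\<phi>. c *\<^sub>R X \<phi> + Y \<phi>) \<in> V"
begin

lemma sum_mem:
  fixes m :: nat
  assumes "\<And>j. j < m \<Longrightarrow> Y j \<in> V"
  shows "(\<lambda>\<phi>. \<Sum>j<m. c j *\<^sub>R Y j \<phi>) \<in> V"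
  using assms
proof (induction m)
  case 0
  then show ?case by (simp add: zero_mem)
next
  case (Suc m)
  then show ?case
    using lincomb_mem[of "Y m" "\<lambda>\<phi>. \<Sum>j<m. c j *\<^sub>R Y j \<phi>" "c m"] by (simp add: add.commute)
qed

end

lemma alt_formsI:
  assumes "\<And>v i X Y c. (\<forall>i<k. v i \<in> V) \<Longrightarrow> i < k \<Longrightarrow> X \<in> V \<Longrightarrow> Y \<in> V \<Longrightarrow>
      \<omega> (v(i := \<lambda>\<phi>. c *\<^sub>R X \<phi> + Y \<phi>)) = c * \<omega> (v(i := X)) + \<omega> (v(i := Y))"
    and "\<And>v i j. (\<forall>i<k. v i \<in> V) \<Longrightarrow> i < k \<Longrightarrow> j < k \<Longrightarrow> i \<noteq> j \<Longrightarrow> v i = v j \<Longrightarrow> \<omega> v = 0"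
    and "\<And>v w. (\<forall>i<k. v i = w i) \<Longrightarrow> \<omega> v = \<omega> w"
    and "\<And>v. \<not> (\<forall>i<k. v i \<in> V) \<Longrightarrow> \<omega> v = 0"
  shows "\<omega> \<in> alt_forms k V"
  using assms unfolding alt_forms_def by blast

text \<open>The old entry of \<open>v\<close> in slot \<open>i\<close> is overwritten and may lie
  outside \<open>V\<close>; the definition is therefore applied to \<open>v(i := X)\<close>.\<close>

lemma alt_forms_lin:
  assumes "\<omega> \<in> alt_forms k V" "\<forall>j<k. j \<noteq> i \<longrightarrow> v j \<in> V" "i < k" "X \<in> V" "Y \<in> V"
  shows "\<omega> (v(i := \<lambda>\<phi>. c *\<^sub>R X \<phi> + Y \<phi>)) = c * \<omega> (v(i := X)) + \<omega> (v(i := Y))"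
proof -
  have "\<forall>j<k. (v(i := X)) j \<in> V"
    using assms by auto
  then have "\<omega> ((v(i := X))(i := \<lambda>\<phi>. c *\<^sub>R X \<phi> + Y \<phi>)) =
      c * \<omega> ((v(i := X))(i := X)) + \<omega> ((v(i := X))(i := Y))"
    using assms unfolding alt_forms_def by blast
  then show ?thesis by simp
qed

lemma alt_forms_outside:
  assumes "\<omega> \<in> alt_forms k V" "i < k" "v i \<notin> V"
  shows "\<omega> v = 0"
  using assms unfolding alt_forms_def by blast

lemma alt_forms_repeat:
  assumes "\<omega> \<in> alt_forms k V" "i < k" "j < k" "i \<noteq> j" "v i = v j"
  shows "\<omega> v = 0"
  using assms unfolding alt_forms_def by blast

lemma alt_forms_cong:
  assumes "\<omega> \<in> alt_forms k V" "\<And>i. i < k \<Longrightarrow> v i = w i"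
  shows "\<omega> v = \<omega> w"
  using assms unfolding alt_forms_def by blast

lemma alt_forms_cmult:
  assumes "\<omega> \<in> alt_forms k V"
  shows "(\<lambda>v. c * \<omega> v) \<in> alt_forms k V"
proof (rule alt_formsI)
  show "c * \<omega> (v(i := \<lambda>\<phi>. d *\<^sub>R X \<phi> + Y \<phi>)) = d * (c * \<omega> (v(i := X))) + c * \<omega> (v(i := Y))"
    if "\<forall>i<k. v i \<in> V" "i < k" "X \<in> V" "Y \<in> V" for v i X Y d
    using alt_forms_lin[OF assms, of i v X Y d] that by (simp add: algebra_simps)
  show "c * \<omega> v = c * \<omega> w" if "\<forall>i<k. v i = w i" for v w
    using alt_forms_cong[OF assms, of v w] that by simp
  show "c * \<omega> v = 0" if "i < k" "j < k" "i \<noteq> j" "v i = v j" for v i j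
    using alt_forms_repeat[OF assms that] by simp
  show "c * \<omega> v = 0" if "\<not> (\<forall>i<k. v i \<in> V)" for v
    using alt_forms_outside[OF assms, of _ v] that by auto
qed

lemma alt_forms_add:
  assumes "\<omega> \<in> alt_forms k V" "\<eta> \<in> alt_forms k V"
  shows "(\<lambda>v. \<omega> v + \<eta> v) \<in> alt_forms k V"
proof (rule alt_formsI)
  show "\<omega> (v(i := \<lambda>\<phi>. d *\<^sub>R X \<phi> + Y \<phi>)) + \<eta> (v(i := \<lambda>\<phi>. d *\<^sub>R X \<phi> + Y \<phi>)) =
      d * (\<omega> (v(i := X)) + \<eta> (v(i := X))) + (\<omega> (v(i := Y)) + \<eta> (v(i := Y)))"
    if "\<forall>i<k. v i \<in> V" "i < k" "X \<in> V" "Y \<in> V" for v i X Y d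
    using alt_forms_lin[OF assms(1), of i v X Y d] alt_forms_lin[OF assms(2), of i v X Y d] that
    by (simp add: algebra_simps)
  show "\<omega> v + \<eta> v = \<omega> w + \<eta> w" if "\<forall>i<k. v i = w i" for v w
    using alt_forms_cong[OF assms(1), of v w] alt_forms_cong[OF assms(2), of v w] that by simp
  show "\<omega> v + \<eta> v = 0" if "i < k" "j < k" "i \<noteq> j" "v i = v j" for v i j
    using alt_forms_repeat[OF assms(1) that] alt_forms_repeat[OF assms(2) that] by simp
  show "\<omega> v + \<eta> v = 0" if "\<not> (\<forall>i<k. v i \<in> V)" for v
    using alt_forms_outside[OF assms(1), of _ v] alt_forms_outside[OF assms(2), of _ v] that by auto
qed

lemma alt_forms_sum:
  assumes "finite A" "\<And>x. x \<in> A \<Longrightarrow> \<omega> x \<in> alt_forms k V"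
  shows "(\<lambda>v. \<Sum>x\<in>A. \<omega> x v) \<in> alt_forms k V"
  using assms
proof (induction A rule: finite_induct)
  case empty
  show ?case by (simp add: alt_forms_def)
next
  case (insert x A)
  then show ?case using alt_forms_add[of "\<omega> x" k V] by simp
qed

context tvec_space
begin

text \<open>Polarization: with \<open>v i + v j\<close> in both slots the form vanishes, and so do
  the two pure terms, which leaves the mixed ones.\<close>

lemma alt_forms_swap:
  assumes \<omega>: "\<omega> \<in> alt_forms k V" and ij: "i < k" "j < k" "i \<noteq> j"
  shows "\<omega> (v \<circ> Transposition.transpose i j) = - \<omega> v"
proof (cases "\<forall>l<k. v l \<in> V")
  case True
  define P where "P X Y = \<omega> (v(i := X, j := Y))" for X Y
  let ?X = "v i" and ?Y = "v j"
  let ?s = "\<lambda>\<phi>. 1 *\<^sub>R ?X \<phi> + ?Y \<phi>"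
  have X: "?X \<in> V" and Y: "?Y \<in> V" and s: "?s \<in> V"
    using True ij by (blast intro: lincomb_mem)+
  have left: "P (\<lambda>\<phi>. 1 *\<^sub>R A \<phi> + B \<phi>) Z = P A Z + P B Z" if "A \<in> V" "B \<in> V" "Z \<in> V" for A B Z
  proof -
    have "P A' Z = \<omega> (v(j := Z, i := A'))" for A'
      using ij by (simp add: P_def fun_upd_twist)
    then show ?thesis
      using alt_forms_lin[OF \<omega>, of i "v(j := Z)" A B 1] that True ij by simp
  qed
  have right: "P Z (\<lambda>\<phi>. 1 *\<^sub>R A \<phi> + B \<phi>) = P Z A + P Z B" if "A \<in> V" "B \<in> V" "Z \<in> V" for A B Z
    using alt_forms_lin[OF \<omega>, of j "v(i := Z)" A B 1] that True ij by (simp add: P_def)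
  have diag: "P Z Z = 0" for Z
    using alt_forms_repeat[OF \<omega>, of i j] ij by (simp add: P_def)
  have "P ?X ?Y + P ?Y ?X = 0"
    using left[OF X Y s] right[OF X Y X] right[OF X Y Y] diag by simp
  moreover have "P ?X ?Y = \<omega> v"
    by (simp add: P_def)
  moreover have "v(i := ?Y, j := ?X) = v \<circ> Transposition.transpose i j"
    using ij by (auto simp: fun_eq_iff Transposition.transpose_def)
  ultimately show ?thesis by (simp add: P_def)
next
  \<comment> \<open>A tuple with an entry outside \<open>V\<close> still has one after the swap, at
    the transposed index, so both sides are the default value 0.\<close>
  case False
  then obtain l where l: "l < k" "v l \<notin> V" by blast
  then have "\<omega> v = 0" by (rule alt_forms_outside[OF \<omega>])
  moreover have "\<omega> (v \<circ> Transposition.transpose i j) = 0"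
    by (rule alt_forms_outside[OF \<omega>, of "Transposition.transpose i j l"]) (use l ij in \<open>auto simp: Transposition.transpose_def\<close>)
  ultimately show ?thesis by simp
qed

text \<open>In the induction on transpositions the tuple varies, since a transposition is absorbed
  into it before the remaining permutation acts.\<close>

lemma alt_forms_permute:
  assumes \<omega>: "\<omega> \<in> alt_forms k V" and "\<tau> permutes {..<k}"
  shows "\<omega> (v \<circ> \<tau>) = of_int (sign \<tau>) * \<omega> v"
  using assms(2) finite_lessThan
proof (induction arbitrary: v rule: permutes_induct)
  case (swap a b p)
  have "\<omega> (v \<circ> (Transposition.transpose a b \<circ> p)) = of_int (sign p) * \<omega> (v \<circ> Transposition.transpose a b)"
    using swap.IH[of "v \<circ> Transposition.transpose a b"] by (simp only: o_assoc)
  also have "\<omega> (v \<circ> Transposition.transpose a b) = - \<omega> v"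
    using swap.hyps by (intro alt_forms_swap[OF \<omega>]) auto
  moreover have "sign (Transposition.transpose a b \<circ> p) = - sign p"
    using swap.hyps permutes_imp_permutation[OF finite_lessThan, of p k]
    by (simp add: sign_compose permutation_swap_id sign_swap_id)
  ultimately show ?case by (simp del: o_apply)
qed simp

lemma alt_forms_eq_0_if_sum:
  fixes m :: nat
  assumes \<omega>: "\<omega> \<in> alt_forms k V" and v: "\<forall>j<k. v j \<in> V" and i: "i < k"
    and e: "\<And>j. j < m \<Longrightarrow> e j \<in> V" "\<And>j. j < m \<Longrightarrow> \<omega> (v(i := e j)) = 0"
  shows "\<omega> (v(i := \<lambda>\<phi>. \<Sum>j<m. c j *\<^sub>R e j \<phi>)) = 0"
  using e
proof (induction m)
  case 0
  \<comment> \<open>Writing the zero vector as \<open>(-1) * 0 + 0\<close> makes linearity produce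
    \<open>- x + x\<close>.\<close>
  have "\<omega> (v(i := \<lambda>\<phi>. (-1) *\<^sub>R (\<lambda>_. 0) \<phi> + (\<lambda>_. 0) \<phi>)) =
      (-1) * \<omega> (v(i := \<lambda>_. 0)) + \<omega> (v(i := \<lambda>_. 0))"
    by (rule alt_forms_lin[OF \<omega> _ i zero_mem zero_mem]) (use v in simp)
  then have "\<omega> (v(i := \<lambda>_. 0)) = 0" by simp
  then show ?case unfolding lessThan_0 sum.empty .
next
  case (Suc m)
  have "\<omega> (v(i := \<lambda>\<phi>. c m *\<^sub>R e m \<phi> + (\<lambda>\<phi>. \<Sum>j<m. c j *\<^sub>R e j \<phi>) \<phi>)) =
      c m * \<omega> (v(i := e m)) + \<omega> (v(i := \<lambda>\<phi>. \<Sum>j<m. c j *\<^sub>R e j \<phi>))"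
    by (rule alt_forms_lin[OF \<omega> _ i _ sum_mem]) (use v Suc.prems in auto)
  moreover have "\<omega> (v(i := e m)) = 0" "\<omega> (v(i := \<lambda>\<phi>. \<Sum>j<m. c j *\<^sub>R e j \<phi>)) = 0"
    using Suc by (auto simp: fun_upd_def)
  ultimately show ?case
    unfolding sum.lessThan_Suc add.commute[of _ "c m *\<^sub>R e m _"] by (simp add: fun_upd_def)
qed

text \<open>Multilinearity holds for each summand \<open>T \<sigma>\<close>, since argument
  \<open>i\<close> is fed to exactly one slot of one factor. Alternation comes from cancellation
  between summands.\<close>

lemma alt_forms_wedge:
  assumes \<alpha>: "\<alpha> \<in> alt_forms k V" and \<beta>: "\<beta> \<in> alt_forms l V"
  shows "wedge k l \<alpha> \<beta> \<in> alt_forms (k + l) V"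
proof -
  define T where
    "T \<sigma> v = \<alpha> (\<lambda>i. v (\<sigma> i)) * \<beta> (\<lambda>i. v (\<sigma> (k + i)))" for \<sigma> :: "nat \<Rightarrow> nat" and v
  define W where "W v = (\<Sum>\<sigma> | \<sigma> permutes {..<k + l}. of_int (sign \<sigma>) * T \<sigma> v)" for v
  have W: "wedge k l \<alpha> \<beta> = (\<lambda>v. (1 / (fact k * fact l)) * W v)"
    by (simp add: wedge_def W_def T_def mult.assoc)
  have "W \<in> alt_forms (k + l) V"
  proof (rule alt_formsI)
    fix v :: "nat \<Rightarrow> ('a, 'n) tvec" and i X Y c
    assume v: "\<forall>i<k + l. v i \<in> V" and i: "i < k + l" and X: "X \<in> V" and Y: "Y \<in> V"
    let ?Z = "\<lambda>\<phi>. c *\<^sub>R X \<phi> + Y \<phi>"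
    have "T \<sigma> (v(i := ?Z)) = c * T \<sigma> (v(i := X)) + T \<sigma> (v(i := Y))"
      if \<sigma>: "\<sigma> permutes {..<k + l}" for \<sigma>
    proof -
      \<comment> \<open>The slot that receives argument \<open>i\<close>: one of
        \<open>\<alpha>\<close> if \<open>m < k\<close>, otherwise slot \<open>m - k\<close> of
        \<open>\<beta>\<close>.\<close>
      define m where "m = inv \<sigma> i"
      have m: "\<sigma> j = i \<longleftrightarrow> j = m" for j
        using permutes_inverses[OF \<sigma>] by (auto simp: m_def)
      have mem: "v (\<sigma> j) \<in> V" if "j < k + l" for j
        using v permutes_in_image[OF \<sigma>, of j] that by auto
      have "m < k + l"
        using permutes_in_image[OF permutes_inv[OF \<sigma>], of i] i by (simp add: m_def)
      then consider "m < k" | q where "m = k + q" "q < l"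
        by (metis add_less_cancel_left le_Suc_ex linorder_not_le)
      then show ?thesis
      proof cases
        case 1
        have "(\<lambda>j. (v(i := Z)) (\<sigma> j)) = (\<lambda>j. v (\<sigma> j))(m := Z)"
          "(\<lambda>j. (v(i := Z)) (\<sigma> (k + j))) = (\<lambda>j. v (\<sigma> (k + j)))" for Z
          using 1 m by (auto simp: fun_eq_iff)
        then show ?thesis
          using alt_forms_lin[OF \<alpha>, of m "\<lambda>j. v (\<sigma> j)" X Y c] 1 X Y mem
          by (simp add: T_def algebra_simps)
      next
        case 2
        have \<alpha>': "\<alpha> (\<lambda>j. (v(i := Z)) (\<sigma> j)) = \<alpha> (\<lambda>j. v (\<sigma> j))" for Z
          using 2 m by (intro alt_forms_cong[OF \<alpha>]) auto
        have "(\<lambda>j. (v(i := Z)) (\<sigma> (k + j))) = (\<lambda>j. v (\<sigma> (k + j)))(q := Z)" for Z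
          using 2 m by (auto simp: fun_eq_iff)
        then have "T \<sigma> (v(i := Z)) = \<alpha> (\<lambda>j. v (\<sigma> j)) * \<beta> ((\<lambda>j. v (\<sigma> (k + j)))(q := Z))" for Z
          unfolding T_def \<alpha>' by simp
        then show ?thesis
          using alt_forms_lin[OF \<beta>, of q "\<lambda>j. v (\<sigma> (k + j))" X Y c] 2 X Y mem
          by (simp add: algebra_simps)
      qed
    qed
    then show "W (v(i := ?Z)) = c * W (v(i := X)) + W (v(i := Y))"
      unfolding W_def sum_distrib_left sum.distrib[symmetric]
      by (intro sum.cong) (auto simp: algebra_simps)
  next
    fix v :: "nat \<Rightarrow> ('a, 'n) tvec" and i j
    assume ij: "i < k + l" "j < k + l" "i \<noteq> j" and eq: "v i = v j"
    let ?t = "Transposition.transpose i j"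
    have t: "?t permutes {..<k + l}"
      using ij by (intro permutes_swap_id) auto
    have vt: "v (?t x) = v x" for x
      using eq by (auto simp: Transposition.transpose_def)
    \<comment> \<open>Composing with the transposition on the left leaves
      \<open>T \<sigma> v\<close> unchanged, because \<open>v i = v j\<close>, and reverses the
      sign; hence \<open>W v = - W v\<close>.\<close>
    have "W v = (\<Sum>\<sigma> | \<sigma> permutes {..<k + l}. of_int (sign (?t \<circ> \<sigma>)) * T (?t \<circ> \<sigma>) v)"
      unfolding W_def by (rule sum.reindex_bij_witness[of _ "(\<circ>) ?t" "(\<circ>) ?t"])
        (auto simp: o_assoc intro: permutes_compose[OF _ t])
    also have "\<dots> = (\<Sum>\<sigma> | \<sigma> permutes {..<k + l}. - (of_int (sign \<sigma>) * T \<sigma> v))"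
    proof (rule sum.cong[OF refl], clarsimp)
      fix \<sigma> assume "\<sigma> permutes {..<k + l}"
      then have "permutation \<sigma>" using permutes_imp_permutation finite_lessThan by blast
      then show "of_int (sign (?t \<circ> \<sigma>)) * T (?t \<circ> \<sigma>) v = - (of_int (sign \<sigma>) * T \<sigma> v)"
        using ij by (simp add: sign_compose permutation_swap_id sign_swap_id T_def vt)
    qed
    also have "\<dots> = - W v" by (simp add: W_def sum_negf)
    finally show "W v = 0" by simp
  next
    fix v w :: "nat \<Rightarrow> ('a, 'n) tvec"
    assume eq: "\<forall>i<k + l. v i = w i"
    have "T \<sigma> v = T \<sigma> w" if \<sigma>: "\<sigma> permutes {..<k + l}" for \<sigma>
    proof -
      have "v (\<sigma> j) = w (\<sigma> j)" if "j < k + l" for j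
        using eq permutes_in_image[OF \<sigma>, of j] that by auto
      then show ?thesis
        unfolding T_def by (intro arg_cong2[where f = "(*)"] alt_forms_cong[OF \<alpha>] alt_forms_cong[OF \<beta>]) auto
    qed
    then show "W v = W w" unfolding W_def by (intro sum.cong) auto
  next
    fix v :: "nat \<Rightarrow> ('a, 'n) tvec"
    assume "\<not> (\<forall>i<k + l. v i \<in> V)"
    then obtain i where i: "i < k + l" "v i \<notin> V" by blast
    have "T \<sigma> v = 0" if \<sigma>: "\<sigma> permutes {..<k + l}" for \<sigma>
    proof -
      define m where "m = inv \<sigma> i"
      have m: "\<sigma> m = i"
        using permutes_inverses(1)[OF \<sigma>] by (simp add: m_def)
      have "m < k + l"
        using permutes_in_image[OF \<sigma>, of m] i by (simp add: m)
      then consider "m < k" | q where "m = k + q" "q < l"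
        by (metis add_less_cancel_left le_Suc_ex linorder_not_le)
      then show ?thesis
      proof cases
        case 1
        then show ?thesis
          using alt_forms_outside[OF \<alpha>, of m "\<lambda>j. v (\<sigma> j)"] i m by (simp add: T_def)
      next
        case 2
        then show ?thesis
          using alt_forms_outside[OF \<beta>, of q "\<lambda>j. v (\<sigma> (k + j))"] i m by (simp add: T_def)
      qed
    qed
    then show "W v = 0" unfolding W_def by (intro sum.neutral) auto
  qed
  then show ?thesis unfolding W by (rule alt_forms_cmult)
qed

end

section \<open>Block permutations\<close>

definition append_args :: "nat \<Rightarrow> (nat \<Rightarrow> 'v) \<Rightarrow> (nat \<Rightarrow> 'v) \<Rightarrow> nat \<Rightarrow> 'v" where
  "append_args k u w = (\<lambda>i. if i < k then u i else w (i - k))"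

lemma comp_append: "e \<circ> append_args k f h = append_args k (e \<circ> f) (e \<circ> h)"
  by (auto simp: append_args_def fun_eq_iff)

lemma append_less:
  assumes "i < k + l" "f \<in> {..<k} \<rightarrow>\<^sub>E {..<n}" "h \<in> {..<l} \<rightarrow>\<^sub>E {..<n}"
  shows "append_args k f h i < n"
proof (cases "i < k")
  case True
  then show ?thesis using assms by (auto simp: append_args_def PiE_iff)
next
  case False
  then have "i - k < l" using assms by simp
  then show ?thesis using assms False by (auto simp: append_args_def PiE_iff)
qed

text \<open>Used for counting: given an injective \<open>h\<close>, the functions \<open>f\<close>
  that complete it to a permutation are the injections into the complement of its range.\<close>

lemma inj_on_append_iff:
  "inj_on (append_args k f h) {..<k + l} \<longleftrightarrow>
     inj_on f {..<k} \<and> inj_on h {..<l} \<and> f ` {..<k} \<inter> h ` {..<l} = {}"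
proof -
  have split: "{..<k + l} = {..<k} \<union> (\<lambda>i. k + i) ` {..<l}"
  proof (intro equalityI subsetI)
    fix i assume "i \<in> {..<k + l}"
    then show "i \<in> {..<k} \<union> (\<lambda>i. k + i) ` {..<l}"
      by (cases "i < k") (auto intro!: image_eqI[of _ _ "i - k"])
  qed auto
  have left: "inj_on (append_args k f h) {..<k} \<longleftrightarrow> inj_on f {..<k}" "append_args k f h ` {..<k} = f ` {..<k}"
    by (auto simp: append_args_def inj_on_def)
  have right: "inj_on (append_args k f h) ((\<lambda>i. k + i) ` {..<l}) \<longleftrightarrow> inj_on h {..<l}"
    "append_args k f h ` (\<lambda>i. k + i) ` {..<l} = h ` {..<l}"
    unfolding image_image by (auto simp: append_args_def inj_on_def)
  have "{..<k} - (\<lambda>i. k + i) ` {..<l} = {..<k}" "(\<lambda>i. k + i) ` {..<l} - {..<k} = (\<lambda>i. k + i) ` {..<l}"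
    by auto
  then show ?thesis
    unfolding split inj_on_Un by (simp add: left right)
qed

text \<open>The cycle of length \<open>n + 1\<close>. The swap of two adjacent blocks is one of its
  powers, which reduces the sign of the swap to that of a cycle.\<close>

definition cyclic_shift :: "nat \<Rightarrow> nat \<Rightarrow> nat" where
  "cyclic_shift n = (\<lambda>i. if i < n then Suc i else if i = n then 0 else i)"

lemma cyclic_shift_permutes_sign:
  "cyclic_shift n permutes {..n} \<and> sign (cyclic_shift n) = (-1) ^ n"
proof (induction n)
  case 0
  have "cyclic_shift 0 = id" by (auto simp: cyclic_shift_def)
  then show ?case by (simp add: permutes_id del: id_apply)
next
  case (Suc n)
  \<comment> \<open>Prolonging the cycle by one point costs one transposition, hence one
    sign.\<close>
  have eq: "cyclic_shift (Suc n) = Transposition.transpose 0 (Suc n) \<circ> cyclic_shift n"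
    by (auto simp: cyclic_shift_def fun_eq_iff Transposition.transpose_def)
  have perm: "cyclic_shift n permutes {..Suc n}"
    using Suc by (auto intro: permutes_subset)
  then have "cyclic_shift (Suc n) permutes {..Suc n}"
    unfolding eq by (intro permutes_compose permutes_swap_id) auto
  moreover have "permutation (cyclic_shift n)"
    using perm permutes_imp_permutation finite_atMost by blast
  ultimately show ?case
    using Suc unfolding eq by (simp add: sign_compose permutation_swap_id sign_swap_id del: o_apply)
qed

text \<open>The shift is addition modulo \<open>n + 1\<close> on \<open>{..n}\<close>; the bound on
  \<open>m\<close> makes one subtraction suffice.\<close>

lemma cyclic_shift_funpow:
  "m \<le> Suc n \<Longrightarrow> (cyclic_shift n ^^ m) i = (if i \<le> n then if i + m \<le> n then i + m else i + m - Suc n else i)"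
  by (induction m) (auto simp: cyclic_shift_def)

lemma sign_funpow:
  assumes "permutation p"
  shows "permutation (p ^^ m) \<and> sign (p ^^ m) = sign p ^ m"
  using assms by (induction m) (auto simp: sign_compose permutation_compose permutation_id simp flip: id_def)

text \<open>The positions are permuted so that reading \<open>append_args k u w\<close> through it
  lists the block \<open>w\<close> before \<open>u\<close>.\<close>

definition block_swap :: "nat \<Rightarrow> nat \<Rightarrow> nat \<Rightarrow> nat" where
  "block_swap k l = (\<lambda>i. if i < l then i + k else if i < k + l then i - l else i)"

lemma block_swap_eq_funpow:
  assumes "k + l = Suc n"
  shows "block_swap k l = cyclic_shift n ^^ k"
proof
  fix i show "block_swap k l i = (cyclic_shift n ^^ k) i"
    using assms by (subst cyclic_shift_funpow) (auto simp: block_swap_def)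
qed

lemma block_swap_permutes: "block_swap k l permutes {..<k + l}"
  by (rule bij_imp_permutes, rule bij_betw_byWitness[where f' = "block_swap l k"])
    (auto simp: block_swap_def)

text \<open>For \<open>k + l = n + 1\<close> the power of the cycle gives
  \<open>(-1) ^ (n * k)\<close>, and \<open>n * k = k * l + k * (k - 1)\<close> has the parity of
  \<open>k * l\<close>. The cycle presupposes a nonempty index set, so \<open>k + l = 0\<close> is
  separate.\<close>

lemma sign_block_swap: "sign (block_swap k l) = (-1) ^ (k * l)"
proof (cases "k + l")
  case 0
  then have "block_swap k l = id" by (auto simp: block_swap_def)
  then show ?thesis using 0 by simp
next
  case (Suc n)
  have "permutation (cyclic_shift n)"
    using cyclic_shift_permutes_sign permutes_imp_permutation finite_atMost by blast
  then have "sign (block_swap k l) = (-1) ^ (n * k)"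
    by (simp add: block_swap_eq_funpow[OF Suc] sign_funpow cyclic_shift_permutes_sign power_mult)
  moreover have "even (n * k) \<longleftrightarrow> even (k * l)"
    using arg_cong[OF Suc, of even] by auto
  ultimately show ?thesis by (simp add: minus_one_power_iff)
qed

lemma append_block_swap:
  assumes "i < k + l"
  shows "(append_args k u w \<circ> block_swap k l) i = append_args l w u i"
  using assms by (auto simp: append_args_def block_swap_def)

text \<open>Index functions from \<open>PiE\<close> are \<open>undefined\<close> beyond
  \<open>n\<close>, whereas a permutation must fix these points; hence the \<open>if\<close>.
  Surjectivity is finiteness.\<close>

lemma permutes_extend_inj:
  fixes f :: "nat \<Rightarrow> nat"
  assumes "inj_on f {..<n}" "\<And>i. i < n \<Longrightarrow> f i < n"
  shows "(\<lambda>i. if i < n then f i else i) permutes {..<n}"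
proof (rule bij_imp_permutes)
  have "f ` {..<n} = {..<n}"
    using assms by (intro endo_inj_surj) auto
  then have "bij_betw f {..<n} {..<n}"
    using assms by (simp add: bij_betw_def)
  then show "bij_betw (\<lambda>i. if i < n then f i else i) {..<n} {..<n}"
    by (rule bij_betw_cong[THEN iffD1, rotated]) simp
qed auto

lemma PiE_Diff_iff:
  assumes "f \<in> A \<rightarrow>\<^sub>E B"
  shows "f \<in> A \<rightarrow>\<^sub>E (B - C) \<longleftrightarrow> f ` A \<inter> C = {}"
  using assms by (auto simp: PiE_iff)

lemma card_PiE_inj:
  assumes "finite T" "card T = m"
  shows "card {h \<in> {..<m} \<rightarrow>\<^sub>E T. inj_on h {..<m}} = fact m"
  using card_inj_on_subset_funcset[of "{..<m}" T "{..<m}"] assms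
  by (simp add: fact_prod_rev atLeast0LessThan)


section \<open>The Hodge star of an inner product space\<close>

text \<open>The star is built from components along the frame, so the metric is recorded here by
  linearity in the first slot, its values on the frame and the expansion in it.\<close>

locale framed_tvec_space = tvec_space V for V :: "('a, 'n::finite) tvec set" +
  fixes g :: "('a, 'n) tvec \<Rightarrow> ('a, 'n) tvec \<Rightarrow> real" and e :: "nat \<Rightarrow> ('a, 'n) tvec" and n :: nat
  assumes g_lincomb: "X \<in> V \<Longrightarrow> Y \<in> V \<Longrightarrow> Z \<in> V \<Longrightarrow>
      g (\<lambda>\<phi>. c *\<^sub>R X \<phi> + Y \<phi>) Z = c * g X Z + g Y Z"
    and e_mem: "i < n \<Longrightarrow> e i \<in> V"
    and e_orth: "i < n \<Longrightarrow> j < n \<Longrightarrow> g (e i) (e j) = (if i = j then 1 else 0)"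
    and e_expansion: "X \<in> V \<Longrightarrow> X = (\<lambda>\<phi>. \<Sum>j<n. g X (e j) *\<^sub>R e j \<phi>)"
begin

text \<open>Leibniz determinant of the components of \<open>v\<close> along the frame; this is
  \<open>vol_form\<close> at one point.\<close>

definition vol :: "(nat \<Rightarrow> ('a, 'n) tvec) \<Rightarrow> real" where
  "vol v = (if \<forall>i<n. v i \<in> V
     then \<Sum>\<sigma> | \<sigma> permutes {..<n}. of_int (sign \<sigma>) * (\<Prod>i<n. g (v i) (e (\<sigma> i))) else 0)"

definition frame_inner ::
    "nat \<Rightarrow> ((nat \<Rightarrow> ('a, 'n) tvec) \<Rightarrow> real) \<Rightarrow> ((nat \<Rightarrow> ('a, 'n) tvec) \<Rightarrow> real) \<Rightarrow> real" where
  "frame_inner k a b = (\<Sum>f\<in>{..<k} \<rightarrow>\<^sub>E {..<n}. a (e \<circ> f) * b (e \<circ> f)) / fact k"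

definition star ::
    "nat \<Rightarrow> ((nat \<Rightarrow> ('a, 'n) tvec) \<Rightarrow> real) \<Rightarrow> (nat \<Rightarrow> ('a, 'n) tvec) \<Rightarrow> real" where
  "star k b = (\<lambda>w. (\<Sum>f\<in>{..<k} \<rightarrow>\<^sub>E {..<n}. b (e \<circ> f) * vol (append_args k (e \<circ> f) w)) / fact k)"

section \<open>The volume form of a frame\<close>

lemma vol_alt: "vol \<in> alt_forms n V"
proof (rule alt_formsI)
  fix v i X Y c
  assume v: "\<forall>i<n. v i \<in> V" and i: "i < n" and X: "X \<in> V" and Y: "Y \<in> V"
  \<comment> \<open>The part of each summand that does not involve slot \<open>i\<close>; the
    summand is \<open>R \<sigma>\<close> times one component of the entry in that slot.\<close>
  define R where "R \<sigma> = of_int (sign \<sigma>) * (\<Prod>j\<in>{..<n} - {i}. g (v j) (e (\<sigma> j)))" for \<sigma> :: "nat \<Rightarrow> nat"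
  have expand: "vol (v(i := Z)) = (\<Sum>\<sigma> | \<sigma> permutes {..<n}. g Z (e (\<sigma> i)) * R \<sigma>)" if "Z \<in> V" for Z
  proof -
    have mem: "\<forall>j<n. (v(i := Z)) j \<in> V" using v that by auto
    have "(\<Prod>j<n. g ((v(i := Z)) j) (e (\<sigma> j))) =
        g Z (e (\<sigma> i)) * (\<Prod>j\<in>{..<n} - {i}. g (v j) (e (\<sigma> j)))" for \<sigma>
      using i by (subst prod.remove[of _ i]) (auto intro!: prod.cong)
    then have "vol (v(i := Z)) = (\<Sum>\<sigma> | \<sigma> permutes {..<n}.
        of_int (sign \<sigma>) * (g Z (e (\<sigma> i)) * (\<Prod>j\<in>{..<n} - {i}. g (v j) (e (\<sigma> j)))))"
      unfolding vol_def if_P[OF mem] by (simp only:)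
    then show ?thesis by (simp add: R_def algebra_simps)
  qed
  have "g (\<lambda>\<phi>. c *\<^sub>R X \<phi> + Y \<phi>) (e (\<sigma> i)) = c * g X (e (\<sigma> i)) + g Y (e (\<sigma> i))"
    if "\<sigma> permutes {..<n}" for \<sigma>
    using permutes_in_image[OF that, of i] i by (intro g_lincomb X Y e_mem) simp
  then show "vol (v(i := \<lambda>\<phi>. c *\<^sub>R X \<phi> + Y \<phi>)) = c * vol (v(i := X)) + vol (v(i := Y))"
    unfolding expand[OF X] expand[OF Y] expand[OF lincomb_mem[OF X Y]]
      sum_distrib_left sum.distrib[symmetric]
    by (intro sum.cong) (auto simp: algebra_simps)
next
  fix v i j
  assume v: "\<forall>i<n. v i \<in> V" and ij: "i < n" "j < n" "i \<noteq> j" and eq: "v i = v j"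
  let ?t = "Transposition.transpose i j"
  have t: "?t permutes {..<n}"
    using ij by (intro permutes_swap_id) auto
  have vt: "v (?t x) = v x" for x
    using eq by (auto simp: Transposition.transpose_def)
  define S where "S = (\<Sum>\<sigma> | \<sigma> permutes {..<n}. of_int (sign \<sigma>) * (\<Prod>i<n. g (v i) (e (\<sigma> i))))"
  \<comment> \<open>Composing with the transposition on the right only reorders the product, since
    rows \<open>i\<close> and \<open>j\<close> agree, while the sign flips; so
    \<open>S = - S\<close>.\<close>
  have "S = (\<Sum>\<sigma> | \<sigma> permutes {..<n}. of_int (sign (\<sigma> \<circ> ?t)) * (\<Prod>i<n. g (v i) (e ((\<sigma> \<circ> ?t) i))))"
    unfolding S_def by (rule sum.reindex_bij_witness[of _ "\<lambda>\<sigma>. \<sigma> \<circ> ?t" "\<lambda>\<sigma>. \<sigma> \<circ> ?t"])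
      (auto simp: comp_assoc intro: permutes_compose[OF t])
  also have "\<dots> = (\<Sum>\<sigma> | \<sigma> permutes {..<n}. - (of_int (sign \<sigma>) * (\<Prod>i<n. g (v i) (e (\<sigma> i)))))"
  proof (rule sum.cong[OF refl], unfold mem_Collect_eq)
    fix \<sigma> assume \<sigma>: "\<sigma> permutes {..<n}"
    then have "permutation \<sigma>" using permutes_imp_permutation finite_lessThan by blast
    moreover have "(\<Prod>i<n. g (v i) (e (\<sigma> i))) = (\<Prod>i<n. g (v i) (e ((\<sigma> \<circ> ?t) i)))"
      using prod.permute[OF t, of "\<lambda>i. g (v i) (e (\<sigma> i))"] by (simp add: vt)
    ultimately show "of_int (sign (\<sigma> \<circ> ?t)) * (\<Prod>i<n. g (v i) (e ((\<sigma> \<circ> ?t) i))) =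
        - (of_int (sign \<sigma>) * (\<Prod>i<n. g (v i) (e (\<sigma> i))))"
      using ij by (simp add: sign_compose permutation_swap_id sign_swap_id)
  qed
  also have "\<dots> = - S" by (simp add: S_def sum_negf)
  finally show "vol v = 0" using v by (simp add: vol_def S_def)
next
  fix v w :: "nat \<Rightarrow> ('a, 'n) tvec"
  assume eq: "\<forall>i<n. v i = w i"
  show "vol v = vol w"
    unfolding vol_def by (rule if_cong) (use eq in auto)
qed (auto simp: vol_def)

lemma vol_frame: "vol e = 1"
proof -
  have "(\<Prod>i<n. g (e i) (e (\<sigma> i))) = (if \<sigma> = id then 1 else 0)" if \<sigma>: "\<sigma> permutes {..<n}" for \<sigma>
  proof (cases "\<sigma> = id")
    case False
    then obtain i where i: "\<sigma> i \<noteq> i" by (auto simp: fun_eq_iff)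
    then have "i < n" using permutes_not_in[OF \<sigma>] by auto
    moreover have "\<sigma> i < n" using permutes_in_image[OF \<sigma>, of i] \<open>i < n\<close> by simp
    ultimately have "g (e i) (e (\<sigma> i)) = 0"
      using i e_orth by simp
    then show ?thesis using False \<open>i < n\<close> by auto
  qed (simp add: e_orth)
  then have "vol e = (\<Sum>\<sigma> | \<sigma> permutes {..<n}. if \<sigma> = id then of_int (sign \<sigma>) else 0)"
    unfolding vol_def by (simp add: e_mem) (intro sum.cong, auto)
  also have "\<dots> = 1"
    by (simp add: finite_permutations permutes_id)
  finally show ?thesis .
qed

lemma vol_permuted_frame:
  assumes "\<sigma> permutes {..<n}"
  shows "vol (e \<circ> \<sigma>) = of_int (sign \<sigma>)"
  using alt_forms_permute[OF vol_alt assms, of e] by (simp add: vol_frame)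

lemma alt_forms_repeated_frame:
  assumes "\<omega> \<in> alt_forms k V" "\<not> inj_on f {..<k}"
  shows "\<omega> (e \<circ> f) = 0"
proof -
  obtain i j where "i < k" "j < k" "i \<noteq> j" "f i = f j"
    using assms(2) by (auto simp: inj_on_def)
  then show ?thesis
    using alt_forms_repeat[OF assms(1), of i j "e \<circ> f"] by simp
qed

text \<open>The value is a sign. The double star contains only its square, so the sign never has to
  be determined.\<close>

lemma vol_inj_frame_square:
  assumes "inj_on f {..<n}" "\<And>i. i < n \<Longrightarrow> f i < n"
  shows "vol (e \<circ> f) * vol (e \<circ> f) = 1"
proof -
  have "vol (e \<circ> f) = vol (e \<circ> (\<lambda>i. if i < n then f i else i))"
    by (rule alt_forms_cong[OF vol_alt]) simp
  also have "\<dots> * \<dots> = 1"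
    by (simp only: vol_permuted_frame[OF permutes_extend_inj[OF assms]] flip: of_int_mult) simp
  finally show ?thesis .
qed

section \<open>Forms determined by their values on the frame\<close>

lemma alt_forms_eq_0:
  assumes \<omega>: "\<omega> \<in> alt_forms k V"
    and zero: "\<And>f. f \<in> {..<k} \<rightarrow>\<^sub>E {..<n} \<Longrightarrow> \<omega> (e \<circ> f) = 0"
  shows "\<omega> v = 0"
proof -
  \<comment> \<open>Induction on the number \<open>m\<close> of leading slots with arbitrary
    entries; the other slots hold frame vectors. Each step expands the entry of one slot in the
    frame.\<close>
  have partial: "\<omega> v = 0" if "\<forall>i<k. if i < m then v i \<in> V else \<exists>j<n. v i = e j" for m v
    using that
  proof (induction m arbitrary: v)
    case 0
    then obtain f where f: "\<And>i. i < k \<Longrightarrow> f i < n \<and> v i = e (f i)"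
      by (metis not_less_zero)
    have "\<omega> v = \<omega> (e \<circ> restrict f {..<k})"
      by (rule alt_forms_cong[OF \<omega>]) (simp add: f)
    also have "\<dots> = 0"
      by (rule zero) (use f in auto)
    finally show ?case .
  next
    case (Suc m)
    show ?case
    proof (cases "m < k")
      case True
      have v: "\<forall>i<k. v i \<in> V"
        using Suc.prems e_mem by (metis (full_types))
      have "\<omega> (v(m := e j)) = 0" if "j < n" for j
        by (rule Suc.IH) (use Suc.prems that in \<open>auto simp: less_Suc_eq\<close>)
      then have "\<omega> (v(m := \<lambda>\<phi>. \<Sum>j<n. g (v m) (e j) *\<^sub>R e j \<phi>)) = 0"
        by (intro alt_forms_eq_0_if_sum[OF \<omega> v True]) (auto simp: e_mem)
      then show ?thesis
        using e_expansion[of "v m"] v True by simp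
    next
      case False
      then show ?thesis using Suc by (metis less_Suc_eq linorder_not_le order_less_trans)
    qed
  qed
  show ?thesis
  proof (cases "\<forall>i<k. v i \<in> V")
    case True
    then show ?thesis by (intro partial[of k]) simp
  next
    case False
    then show ?thesis using alt_forms_outside[OF \<omega>] by blast
  qed
qed

lemma alt_forms_eqI:
  assumes "\<omega> \<in> alt_forms k V" "\<eta> \<in> alt_forms k V"
    and "\<And>f. f \<in> {..<k} \<rightarrow>\<^sub>E {..<n} \<Longrightarrow> \<omega> (e \<circ> f) = \<eta> (e \<circ> f)"
  shows "\<omega> = \<eta>"
proof
  fix v
  have "(\<lambda>v. \<omega> v + (-1) * \<eta> v) \<in> alt_forms k V"
    by (rule alt_forms_add[OF assms(1) alt_forms_cmult[OF assms(2)]])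
  then have "\<omega> v + (-1) * \<eta> v = 0"
    by (rule alt_forms_eq_0) (simp add: assms(3))
  then show "\<omega> v = \<eta> v" by simp
qed

text \<open>An injective index function in top degree is a permutation, so its frame value is a sign
  times the value on \<open>e\<close>; repeated indices give 0.\<close>

lemma top_forms_eqI:
  assumes \<omega>: "\<omega> \<in> alt_forms n V" and \<eta>: "\<eta> \<in> alt_forms n V" and eq: "\<omega> e = \<eta> e"
  shows "\<omega> = \<eta>"
proof (rule alt_forms_eqI[OF \<omega> \<eta>])
  fix f assume f: "f \<in> {..<n} \<rightarrow>\<^sub>E {..<n}"
  show "\<omega> (e \<circ> f) = \<eta> (e \<circ> f)"
  proof (cases "inj_on f {..<n}")
    case True
    let ?\<sigma> = "\<lambda>i. if i < n then f i else i"
    have \<sigma>: "?\<sigma> permutes {..<n}"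
      using f by (intro permutes_extend_inj[OF True]) auto
    have frame: "\<omega>' (e \<circ> f) = of_int (sign ?\<sigma>) * \<omega>' e" if "\<omega>' \<in> alt_forms n V" for \<omega>'
      unfolding alt_forms_permute[OF that \<sigma>, symmetric] by (rule alt_forms_cong[OF that]) simp
    show ?thesis unfolding frame[OF \<omega>] frame[OF \<eta>] eq ..
  next
    case False
    then show ?thesis using \<omega> \<eta> by (simp add: alt_forms_repeated_frame)
  qed
qed

section \<open>Interior products and the contraction star\<close>

lemma alt_forms_append:
  assumes \<omega>: "\<omega> \<in> alt_forms (k + l) V" and u: "\<forall>i<k. u i \<in> V"
  shows "(\<lambda>w. \<omega> (append_args k u w)) \<in> alt_forms l V"
proof (rule alt_formsI)
  show "\<omega> (append_args k u (w(i := \<lambda>\<phi>. c *\<^sub>R X \<phi> + Y \<phi>))) =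
      c * \<omega> (append_args k u (w(i := X))) + \<omega> (append_args k u (w(i := Y)))"
    if w: "\<forall>i<l. w i \<in> V" and i: "i < l" and XY: "X \<in> V" "Y \<in> V" for w i X Y c
  proof -
    have upd: "append_args k u (w(i := Z)) = (append_args k u w)(k + i := Z)" for Z
      by (auto simp: append_args_def fun_eq_iff)
    show ?thesis
      unfolding upd by (rule alt_forms_lin[OF \<omega>]) (use w u i XY in \<open>auto simp: append_args_def\<close>)
  qed
  show "\<omega> (append_args k u w) = 0" if "i < l" "j < l" "i \<noteq> j" "w i = w j" for w i j
    using that by (intro alt_forms_repeat[OF \<omega>, of "k + i" "k + j"]) (auto simp: append_args_def)
  show "\<omega> (append_args k u v) = \<omega> (append_args k u w)" if "\<forall>i<l. v i = w i" for v w
    using that by (intro alt_forms_cong[OF \<omega>]) (auto simp: append_args_def)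
  show "\<omega> (append_args k u w) = 0" if outside: "\<not> (\<forall>i<l. w i \<in> V)" for w
  proof -
    obtain i where "i < l" "w i \<notin> V" using outside by blast
    then show ?thesis
      by (intro alt_forms_outside[OF \<omega>, of "k + i"]) (auto simp: append_args_def)
  qed
qed

lemma star_alt:
  assumes "k + l = n"
  shows "star k b \<in> alt_forms l V"
proof -
  have "(\<lambda>w. (1 / fact k) * (\<Sum>f\<in>{..<k} \<rightarrow>\<^sub>E {..<n}. b (e \<circ> f) * vol (append_args k (e \<circ> f) w))) \<in> alt_forms l V"
    using vol_alt assms
    by (intro alt_forms_cmult alt_forms_sum alt_forms_append finite_PiE) (auto intro!: e_mem)
  then show ?thesis by (simp add: star_def)
qed

lemma star_cmult: "star k (\<lambda>v. c * b v) = (\<lambda>w. c * star k b w)"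
  by (simp add: star_def sum_distrib_left mult.assoc)

lemma append_commute:
  assumes "\<omega> \<in> alt_forms n V" "k + l = n"
  shows "\<omega> (append_args l w u) = (-1) ^ (k * l) * \<omega> (append_args k u w)"
proof -
  have "\<omega> (append_args l w u) = \<omega> (append_args k u w \<circ> block_swap k l)"
    using assms(2) by (intro alt_forms_cong[OF assms(1)] append_block_swap[symmetric]) simp
  also have "\<dots> = (-1) ^ (k * l) * \<omega> (append_args k u w)"
    using alt_forms_permute[OF assms(1), of "block_swap k l"] block_swap_permutes[of k l] assms(2)
    by (simp add: sign_block_swap)
  finally show ?thesis .
qed

section \<open>Wedge products evaluated on the frame\<close>

lemma wedge_frame:
  assumes kl: "k + l = n" and \<alpha>: "\<alpha> \<in> alt_forms k V" and \<beta>: "\<beta> \<in> alt_forms l V"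
  shows "wedge k l \<alpha> \<beta> e =
    (\<Sum>f\<in>{..<k} \<rightarrow>\<^sub>E {..<n}. \<Sum>h\<in>{..<l} \<rightarrow>\<^sub>E {..<n}.
       vol (append_args k (e \<circ> f) (e \<circ> h)) * \<alpha> (e \<circ> f) * \<beta> (e \<circ> h)) / (fact k * fact l)"
proof -
  let ?F = "{..<k} \<rightarrow>\<^sub>E {..<n}" and ?H = "{..<l} \<rightarrow>\<^sub>E {..<n}"
  \<comment> \<open>A permutation of the \<open>k + l\<close> slots is the same as a pair
    \<open>(f, h)\<close> with injective concatenation, and its sign is the volume of the frame in
    that order.\<close>
  define J where "J = {(f, h) \<in> ?F \<times> ?H. inj_on (append_args k f h) {..<n}}"
  define t where "t = (\<lambda>(f, h). vol (append_args k (e \<circ> f) (e \<circ> h)) * \<alpha> (e \<circ> f) * \<beta> (e \<circ> h))"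
  define to_pair where
    "to_pair \<sigma> = (restrict \<sigma> {..<k}, restrict (\<lambda>i. \<sigma> (k + i)) {..<l})" for \<sigma> :: "nat \<Rightarrow> nat"
  define to_perm where
    "to_perm = (\<lambda>(f, h) i. if i < n then append_args k f h i else (i::nat))"
  have less: "append_args k f h i < n" if "f \<in> ?F" "h \<in> ?H" "i < n" for f h i
    using append_less that kl by metis
  have append_pair: "append_args k (restrict \<sigma> {..<k}) (restrict (\<lambda>i. \<sigma> (k + i)) {..<l}) i = \<sigma> i"
    if "i < n" for \<sigma> i
    using that kl by (auto simp: append_args_def)
  have "(\<Sum>\<sigma> | \<sigma> permutes {..<n}. of_int (sign \<sigma>) * \<alpha> (\<lambda>i. e (\<sigma> i)) * \<beta> (\<lambda>i. e (\<sigma> (k + i)))) = sum t J"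
  proof (rule sum.reindex_bij_witness[of _ to_perm to_pair])
    fix \<sigma> assume "\<sigma> \<in> {\<sigma>. \<sigma> permutes {..<n}}"
    then have \<sigma>: "\<sigma> permutes {..<n}" by simp
    show "to_perm (to_pair \<sigma>) = \<sigma>"
      using permutes_not_in[OF \<sigma>] by (auto simp: to_perm_def to_pair_def append_pair fun_eq_iff)
    have "\<sigma> i < n" if "i < n" for i
      using permutes_in_image[OF \<sigma>, of i] that by simp
    moreover have "inj_on (append_args k (restrict \<sigma> {..<k}) (restrict (\<lambda>i. \<sigma> (k + i)) {..<l})) {..<n}"
      by (subst inj_on_cong[of _ _ \<sigma>]) (auto simp: append_pair intro: permutes_inj_on[OF \<sigma>])
    ultimately show "to_pair \<sigma> \<in> J"
      using kl by (auto simp: J_def to_pair_def)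
    have "vol (append_args k (e \<circ> restrict \<sigma> {..<k}) (e \<circ> restrict (\<lambda>i. \<sigma> (k + i)) {..<l})) = vol (e \<circ> \<sigma>)"
      unfolding comp_append[symmetric] by (rule alt_forms_cong[OF vol_alt]) (simp add: append_pair)
    moreover have "\<alpha> (e \<circ> restrict \<sigma> {..<k}) = \<alpha> (\<lambda>i. e (\<sigma> i))"
      by (rule alt_forms_cong[OF \<alpha>]) simp
    moreover have "\<beta> (e \<circ> restrict (\<lambda>i. \<sigma> (k + i)) {..<l}) = \<beta> (\<lambda>i. e (\<sigma> (k + i)))"
      by (rule alt_forms_cong[OF \<beta>]) simp
    ultimately show "t (to_pair \<sigma>) =
        of_int (sign \<sigma>) * \<alpha> (\<lambda>i. e (\<sigma> i)) * \<beta> (\<lambda>i. e (\<sigma> (k + i)))"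
      by (simp only: t_def to_pair_def prod.case vol_permuted_frame[OF \<sigma>])
  next
    fix x assume "x \<in> J"
    then obtain f h where x: "x = (f, h)" and f: "f \<in> ?F" and h: "h \<in> ?H"
      and inj: "inj_on (append_args k f h) {..<n}"
      by (auto simp: J_def)
    show "to_perm x \<in> {\<sigma>. \<sigma> permutes {..<n}}"
      using permutes_extend_inj[OF inj less[OF f h]] by (simp add: to_perm_def x)
    have "restrict (\<lambda>i. if i < n then append_args k f h i else i) {..<k} = f"
      using f kl by (auto simp: fun_eq_iff append_args_def PiE_iff extensional_def)
    moreover have "restrict (\<lambda>i. if k + i < n then append_args k f h (k + i) else k + i) {..<l} = h"
      using h kl by (auto simp: fun_eq_iff append_args_def PiE_iff extensional_def)
    ultimately show "to_pair (to_perm x) = x"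
      by (simp add: to_pair_def to_perm_def x)
  qed
  also have "\<dots> = sum t (?F \<times> ?H)"
  proof (rule sum.mono_neutral_left)
    show "finite (?F \<times> ?H)" by (simp add: finite_PiE)
    show "\<forall>x\<in>?F \<times> ?H - J. t x = 0"
    proof (clarify)
      fix f h assume "f \<in> ?F" "h \<in> ?H" "(f, h) \<notin> J"
      then have "vol (append_args k (e \<circ> f) (e \<circ> h)) = 0"
        unfolding comp_append[symmetric] by (intro alt_forms_repeated_frame[OF vol_alt]) (simp add: J_def)
      then show "t (f, h) = 0" by (simp add: t_def)
    qed
  qed (auto simp: J_def)
  also have "\<dots> = (\<Sum>f\<in>?F. \<Sum>h\<in>?H. t (f, h))"
    by (simp add: sum.cartesian_product)
  finally show ?thesis
    by (simp add: wedge_def kl t_def)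
qed

text \<open>For fixed \<open>h\<close>, the sum over \<open>f\<close> in \<open>wedge_frame\<close>
  is, up to a factorial, the contraction of \<open>\<alpha>\<close> on \<open>e \<circ> h\<close>;
  pairing it with \<open>\<beta>\<close> gives the inner product. This adjunction drives both the
  isometry and the uniqueness proof.\<close>

lemma wedge_frame_eq_inner_star:
  assumes "k + l = n" "\<alpha> \<in> alt_forms k V" "\<beta> \<in> alt_forms l V"
  shows "wedge k l \<alpha> \<beta> e = frame_inner l (star k \<alpha>) \<beta>"
proof -
  have "frame_inner l (star k \<alpha>) \<beta> = (\<Sum>h\<in>{..<l} \<rightarrow>\<^sub>E {..<n}. \<Sum>f\<in>{..<k} \<rightarrow>\<^sub>E {..<n}.
       vol (append_args k (e \<circ> f) (e \<circ> h)) * \<alpha> (e \<circ> f) * \<beta> (e \<circ> h)) / (fact k * fact l)"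
    by (simp add: frame_inner_def star_def sum_divide_distrib sum_distrib_left sum_distrib_right algebra_simps)
  then show ?thesis
    unfolding wedge_frame[OF assms] by (subst sum.swap) simp
qed

lemma wedge_frame_commute:
  assumes "k + l = n" "\<alpha> \<in> alt_forms k V" "\<beta> \<in> alt_forms l V"
  shows "wedge l k \<beta> \<alpha> e = (-1) ^ (k * l) * wedge k l \<alpha> \<beta> e"
proof -
  have "wedge l k \<beta> \<alpha> e = (\<Sum>h\<in>{..<l} \<rightarrow>\<^sub>E {..<n}. \<Sum>f\<in>{..<k} \<rightarrow>\<^sub>E {..<n}.
       (-1) ^ (k * l) * (vol (append_args k (e \<circ> f) (e \<circ> h)) * \<alpha> (e \<circ> f) * \<beta> (e \<circ> h))) / (fact k * fact l)"
    using assms(1)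
    by (subst wedge_frame[OF _ assms(3,2)])
      (simp_all add: append_commute[OF vol_alt assms(1)] add.commute algebra_simps)
  then show ?thesis
    unfolding wedge_frame[OF assms] by (subst sum.swap) (simp add: sum_distrib_left)
qed

section \<open>The double star\<close>

lemma vol_append_reorder:
  assumes kl: "k + l = n" and b: "b \<in> alt_forms k V"
    and f: "f \<in> {..<k} \<rightarrow>\<^sub>E {..<n}" and q: "q \<in> {..<k} \<rightarrow>\<^sub>E {..<n}" and h: "h \<in> {..<l} \<rightarrow>\<^sub>E {..<n}"
    and inj_f: "inj_on (append_args k f h) {..<n}" and inj_q: "inj_on (append_args k q h) {..<n}"
  shows "b (e \<circ> f) * vol (append_args k (e \<circ> f) (e \<circ> h)) = b (e \<circ> q) * vol (append_args k (e \<circ> q) (e \<circ> h))"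
proof -
  let ?T = "{..<n} - h ` {..<l}"
  have f': "inj_on f {..<k}" "f ` {..<k} \<inter> h ` {..<l} = {}"
    and q': "inj_on q {..<k}" "q ` {..<k} \<inter> h ` {..<l} = {}" and h': "inj_on h {..<l}"
    using inj_f inj_q unfolding kl[symmetric] inj_on_append_iff by auto
  have "card ?T = k"
    using h h' kl by (subst card_Diff_subset) (auto simp: card_image)
  have onto: "p ` {..<k} = ?T" if "p \<in> {..<k} \<rightarrow>\<^sub>E {..<n}" "inj_on p {..<k}" "p ` {..<k} \<inter> h ` {..<l} = {}" for p
    by (rule card_subset_eq) (use that \<open>card ?T = k\<close> in \<open>auto simp: card_image\<close>)
  \<comment> \<open>Both \<open>f\<close> and \<open>q\<close> are bijections onto the complement of
    the range of \<open>h\<close>, so they differ by the inverse of \<open>q\<close> after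
    \<open>f\<close>. Extended by the identity, this permutation reorders the slots of
    \<open>b\<close> and of \<open>vol\<close>, and its sign occurs twice.\<close>
  define \<tau> where "\<tau> i = (if i < k then inv_into {..<k} q (f i) else i)" for i
  have range: "f i \<in> q ` {..<k}" if "i < k" for i
    using onto[OF f f'] onto[OF q q'] that by auto
  have q\<tau>: "q (\<tau> i) = f i" if "i < k" for i
    using f_inv_into_f[OF range[OF that]] that by (simp add: \<tau>_def)
  have "inj_on (\<lambda>i. inv_into {..<k} q (f i)) {..<k}"
    using f'(1) range by (auto simp: inj_on_def dest!: inv_into_injective)
  then have \<tau>: "\<tau> permutes {..<k}"
    unfolding \<tau>_def using inv_into_into[OF range] by (intro permutes_extend_inj) auto
  have "b (e \<circ> f) = of_int (sign \<tau>) * b (e \<circ> q)"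
    unfolding alt_forms_permute[OF b \<tau>, symmetric] by (rule alt_forms_cong[OF b]) (simp add: q\<tau>)
  moreover have "\<tau> i < k \<longleftrightarrow> i < k" for i
    using permutes_in_image[OF \<tau>, of i] by simp
  then have "append_args k f h = append_args k q h \<circ> \<tau>"
    using permutes_not_in[OF \<tau>] by (auto simp: append_args_def fun_eq_iff q\<tau>)
  then have "vol (append_args k (e \<circ> f) (e \<circ> h)) = vol (append_args k (e \<circ> q) (e \<circ> h) \<circ> \<tau>)"
    by (simp only: o_assoc flip: comp_append)
  moreover have "\<tau> permutes {..<n}"
    using \<tau> by (rule permutes_subset) (use kl in auto)
  then have "vol (append_args k (e \<circ> q) (e \<circ> h) \<circ> \<tau>) = of_int (sign \<tau>) * vol (append_args k (e \<circ> q) (e \<circ> h))"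
    by (rule alt_forms_permute[OF vol_alt])
  moreover have "of_int (sign \<tau>) * of_int (sign \<tau>) = (1::real)"
    by (simp flip: of_int_mult)
  ultimately show ?thesis by (simp add: algebra_simps)
qed

lemma vol_append_eq_0:
  assumes "k + l = n" "\<not> inj_on (append_args k f h) {..<n}"
  shows "vol (append_args k (e \<circ> f) (e \<circ> h)) = 0"
  using alt_forms_repeated_frame[OF vol_alt assms(2)] by (simp only: comp_append)

text \<open>For fixed injective \<open>h\<close>, the \<open>f\<close> that complete it to a
  permutation number \<open>fact k\<close> and contribute equally; for fixed injective
  \<open>q\<close> there are \<open>fact l\<close> complementary \<open>h\<close>, each contributing
  the square of a sign. The factorials cancel the weights of the two stars, and the power of -1
  comes from moving the block \<open>h\<close> past \<open>q\<close>.\<close>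

lemma star_star:
  assumes kl: "k + l = n" and b: "b \<in> alt_forms k V"
  shows "star l (star k b) = (\<lambda>v. (-1) ^ (k * l) * b v)"
proof (rule alt_forms_eqI)
  show "star l (star k b) \<in> alt_forms k V"
    using kl by (intro star_alt) simp
  show "(\<lambda>v. (-1) ^ (k * l) * b v) \<in> alt_forms k V"
    using b by (rule alt_forms_cmult)
  let ?F = "{..<k} \<rightarrow>\<^sub>E {..<n}" and ?H = "{..<l} \<rightarrow>\<^sub>E {..<n}"
  fix q assume q: "q \<in> ?F"
  define E where "E f h = vol (append_args k (e \<circ> f) (e \<circ> h))" for f h :: "nat \<Rightarrow> nat"
  \<comment> \<open>The factor \<open>E q h\<close> makes both sides 0 unless \<open>q\<close> and
    \<open>h\<close> are complementary.\<close>
  have inner_sum: "(\<Sum>f\<in>?F. b (e \<circ> f) * E f h) * E q h = fact k * (b (e \<circ> q) * (E q h * E q h))"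
    if h: "h \<in> ?H" for h
  proof (cases "inj_on (append_args k q h) {..<n}")
    case True
    let ?T = "{..<n} - h ` {..<l}"
    define J where "J = {f \<in> {..<k} \<rightarrow>\<^sub>E ?T. inj_on f {..<k}}"
    have h': "inj_on h {..<l}"
      using True unfolding kl[symmetric] inj_on_append_iff by simp
    have J: "f \<in> J \<longleftrightarrow> inj_on (append_args k f h) {..<n}" if "f \<in> ?F" for f
      using inj_on_append_iff[of k f h l] kl h' PiE_Diff_iff[OF that, of "h ` {..<l}"]
      by (auto simp: J_def)
    have "J \<subseteq> ?F"
      using PiE_mono[of "{..<k}" "\<lambda>_. ?T" "\<lambda>_. {..<n}"] by (auto simp: J_def)
    have "card ?T = k"
      using h h' kl by (subst card_Diff_subset) (auto simp: card_image)
    then have "card J = fact k"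
      unfolding J_def by (intro card_PiE_inj) auto
    have "(\<Sum>f\<in>?F. b (e \<circ> f) * E f h) = (\<Sum>f\<in>J. b (e \<circ> f) * E f h)"
      using \<open>J \<subseteq> ?F\<close> J vol_append_eq_0[OF kl]
      by (intro sum.mono_neutral_right) (auto simp: E_def finite_PiE)
    also have "\<dots> = (\<Sum>f\<in>J. b (e \<circ> q) * E q h)"
      using \<open>J \<subseteq> ?F\<close> J unfolding E_def
      by (intro sum.cong refl vol_append_reorder[OF kl b _ q h _ True]) auto
    also have "\<dots> = fact k * (b (e \<circ> q) * E q h)"
      by (simp add: \<open>card J = fact k\<close>)
    finally show ?thesis by simp
  next
    case False
    then show ?thesis by (simp add: E_def vol_append_eq_0[OF kl])
  qed
  \<comment> \<open>The factor \<open>b (e \<circ> q)\<close> covers a repeated index in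
    \<open>q\<close>, where it is 0.\<close>
  have outer_sum: "b (e \<circ> q) * (\<Sum>h\<in>?H. E q h * E q h) = fact l * b (e \<circ> q)"
  proof (cases "inj_on q {..<k}")
    case True
    let ?T = "{..<n} - q ` {..<k}"
    define J where "J = {h \<in> {..<l} \<rightarrow>\<^sub>E ?T. inj_on h {..<l}}"
    have J: "h \<in> J \<longleftrightarrow> inj_on (append_args k q h) {..<n}" if "h \<in> ?H" for h
      using inj_on_append_iff[of k q h l] kl True PiE_Diff_iff[OF that, of "q ` {..<k}"]
      by (auto simp: J_def)
    have "J \<subseteq> ?H"
      using PiE_mono[of "{..<l}" "\<lambda>_. ?T" "\<lambda>_. {..<n}"] by (auto simp: J_def)
    have "card ?T = l"
      using q True kl by (subst card_Diff_subset) (auto simp: card_image)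
    then have "card J = fact l"
      unfolding J_def by (intro card_PiE_inj) auto
    have "(\<Sum>h\<in>?H. E q h * E q h) = (\<Sum>h\<in>J. E q h * E q h)"
      using \<open>J \<subseteq> ?H\<close> J vol_append_eq_0[OF kl]
      by (intro sum.mono_neutral_right) (auto simp: E_def finite_PiE)
    also have "\<dots> = (\<Sum>h\<in>J. 1)"
    proof (rule sum.cong[OF refl])
      fix h assume "h \<in> J"
      then have h: "h \<in> ?H" using \<open>J \<subseteq> ?H\<close> by blast
      show "E q h * E q h = 1"
        unfolding E_def comp_append[symmetric]
        by (rule vol_inj_frame_square) (use J[OF h] \<open>h \<in> J\<close> append_less[OF _ q h] kl in auto)
    qed
    finally show ?thesis by (simp add: \<open>card J = fact l\<close>)
  next
    case False
    then show ?thesis using alt_forms_repeated_frame[OF b] by simp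
  qed
  have "star l (star k b) (e \<circ> q) =
      (\<Sum>h\<in>?H. (\<Sum>f\<in>?F. b (e \<circ> f) * E f h) * ((-1) ^ (k * l) * E q h)) / (fact k * fact l)"
    unfolding star_def E_def append_commute[OF vol_alt kl]
    by (simp flip: sum_divide_distrib)
  also have "\<dots> = (-1) ^ (k * l) * (\<Sum>h\<in>?H. (\<Sum>f\<in>?F. b (e \<circ> f) * E f h) * E q h) / (fact k * fact l)"
    by (simp add: sum_distrib_left algebra_simps)
  also have "(\<Sum>h\<in>?H. (\<Sum>f\<in>?F. b (e \<circ> f) * E f h) * E q h) =
      fact k * (b (e \<circ> q) * (\<Sum>h\<in>?H. E q h * E q h))"
    by (simp add: inner_sum sum_distrib_left cong: sum.cong)
  also have "\<dots> = fact k * (fact l * b (e \<circ> q))"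
    by (simp only: outer_sum)
  finally show "star l (star k b) (e \<circ> q) = (-1) ^ (k * l) * b (e \<circ> q)"
    by (simp del: o_apply)
qed

section \<open>Isometry and uniqueness of the star\<close>

lemma frame_inner_cmult_left: "frame_inner k (\<lambda>v. c * a v) b = c * frame_inner k a b"
  by (simp add: frame_inner_def sum_distrib_left mult.assoc)

lemma frame_inner_commute: "frame_inner k a b = frame_inner k b a"
  by (simp add: frame_inner_def mult.commute)

lemma frame_inner_eq_0D:
  assumes "\<omega> \<in> alt_forms k V" "frame_inner k \<omega> \<omega> = 0"
  shows "\<omega> v = 0"
proof (rule alt_forms_eq_0[OF assms(1)])
  have "(\<Sum>f\<in>{..<k} \<rightarrow>\<^sub>E {..<n}. \<omega> (e \<circ> f) * \<omega> (e \<circ> f)) = 0"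
    using assms(2) by (simp add: frame_inner_def)
  then show "\<omega> (e \<circ> f) = 0" if "f \<in> {..<k} \<rightarrow>\<^sub>E {..<n}" for f
    using that by (subst (asm) sum_nonneg_eq_0_iff) (auto simp: finite_PiE)
qed

text \<open>One wedge product, evaluated in both orders: \<open>(star a, star b)\<close> on one side
  and \<open>(star (star b), a)\<close> on the other. The sign of exchanging the factors cancels
  that of the double star.\<close>

lemma star_isometry:
  assumes kl: "k + l = n" and a: "a \<in> alt_forms k V" and b: "b \<in> alt_forms k V"
  shows "frame_inner l (star k a) (star k b) = frame_inner k a b"
proof -
  have lk: "l + k = n" using kl by simp
  have "(-1) ^ (k * l) * frame_inner l (star k a) (star k b) = (-1) ^ (k * l) * wedge k l a (star k b) e"
    using wedge_frame_eq_inner_star[OF kl a star_alt[OF kl]] by simp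
  also have "\<dots> = wedge l k (star k b) a e"
    using wedge_frame_commute[OF kl a star_alt[OF kl]] by simp
  also have "\<dots> = frame_inner k (star l (star k b)) a"
    by (rule wedge_frame_eq_inner_star[OF lk star_alt[OF kl] a])
  also have "\<dots> = (-1) ^ (k * l) * frame_inner k a b"
    by (simp add: star_star[OF kl b] frame_inner_cmult_left frame_inner_commute)
  finally show ?thesis by simp
qed

lemma wedge_star:
  assumes kl: "k + l = n" and a: "a \<in> alt_forms k V" and b: "b \<in> alt_forms k V"
  shows "wedge k l a (star k b) = (\<lambda>v. frame_inner k a b * vol v)"
proof (rule top_forms_eqI)
  show "wedge k l a (star k b) \<in> alt_forms n V"
    using alt_forms_wedge[OF a star_alt[OF kl]] kl by simp
  show "(\<lambda>v. frame_inner k a b * vol v) \<in> alt_forms n V"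
    by (rule alt_forms_cmult[OF vol_alt])
  show "wedge k l a (star k b) e = frame_inner k a b * vol e"
    by (simp add: wedge_frame_eq_inner_star[OF kl a star_alt[OF kl]] star_isometry[OF kl a b] vol_frame)
qed

lemma wedge_cancel:
  assumes kl: "k + l = n" and \<eta>: "\<eta> \<in> alt_forms l V" and \<theta>: "\<theta> \<in> alt_forms l V"
    and eq: "\<And>a. a \<in> alt_forms k V \<Longrightarrow> wedge k l a \<eta> = wedge k l a \<theta>"
  shows "\<eta> = \<theta>"
proof
  fix v
  have lk: "l + k = n" using kl by simp
  define \<delta> where "\<delta> v = \<eta> v + (-1) * \<theta> v" for v
  have \<delta>: "\<delta> \<in> alt_forms l V"
    unfolding \<delta>_def by (intro alt_forms_add alt_forms_cmult \<eta> \<theta>)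
  \<comment> \<open>The test form is the star of the difference \<open>\<delta>\<close>: the double
    star returns \<open>\<delta>\<close> up to sign, so both solutions have the same inner product
    with it.\<close>
  have a: "star l \<delta> \<in> alt_forms k V" by (rule star_alt[OF lk])
  have "frame_inner l (star k (star l \<delta>)) \<eta> = frame_inner l (star k (star l \<delta>)) \<theta>"
    using eq[OF a] wedge_frame_eq_inner_star[OF kl a \<eta>] wedge_frame_eq_inner_star[OF kl a \<theta>] by simp
  then have "frame_inner l \<delta> \<eta> = frame_inner l \<delta> \<theta>"
    by (simp add: star_star[OF lk \<delta>] frame_inner_cmult_left)
  moreover have "frame_inner l \<delta> \<delta> = frame_inner l \<delta> \<eta> - frame_inner l \<delta> \<theta>"
    by (simp add: frame_inner_def \<delta>_def algebra_simps sum_subtractf sum.distrib sum_distrib_left flip: diff_divide_distrib)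
  ultimately have "\<delta> v = 0"
    by (intro frame_inner_eq_0D[OF \<delta>]) simp
  then show "\<eta> v = \<theta> v" by (simp add: \<delta>_def)
qed

lemma the_star:
  assumes kl: "k + l = n" and b: "b \<in> alt_forms k V"
  shows "(THE \<eta>. \<eta> \<in> alt_forms l V \<and>
      (\<forall>a\<in>alt_forms k V. wedge k l a \<eta> = (\<lambda>v. frame_inner k a b * vol v))) = star k b"
proof (rule the_equality)
  show "star k b \<in> alt_forms l V \<and>
      (\<forall>a\<in>alt_forms k V. wedge k l a (star k b) = (\<lambda>v. frame_inner k a b * vol v))"
    using star_alt[OF kl] wedge_star[OF kl _ b] by blast
  show "\<eta> = star k b" if "\<eta> \<in> alt_forms l V \<and>
      (\<forall>a\<in>alt_forms k V. wedge k l a \<eta> = (\<lambda>v. frame_inner k a b * vol v))" for \<eta>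
    using that by (intro wedge_cancel[OF kl _ star_alt[OF kl]]) (auto simp: wedge_star[OF kl _ b])
qed

end

section \<open>Tangent spaces\<close>

lemma smooth_on_imp_differentiable:
  assumes "smooth_on S f" "x \<in> S"
  shows "f differentiable (at x within S)"
proof -
  obtain W h where W: "open W" "x \<in> W" and h: "\<forall>k. Ck_on k W h" and eq: "\<forall>y\<in>W \<inter> S. h y = f y"
    using assms unfolding smooth_on_def by blast
  from h have "Ck_on (Suc 0) W h" by blast
  then obtain D where "(h has_derivative D) (at x)"
    using W by (auto simp: differentiable_def)
  then have "(h has_derivative D) (at x within S)"
    by (rule has_derivative_at_withinI)
  moreover obtain d where "0 < d" "ball x d \<subseteq> W"
    using W open_contains_ball by blast
  ultimately have "(f has_derivative D) (at x within S)"
    using eq assms(2) by (elim has_derivative_transform_within) (auto simp: dist_commute subset_iff)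
  then show ?thesis by (auto simp: differentiable_def)
qed

text \<open>A sector contains the ray from each of its points in each of its directions, which determines
  the derivative on the sector, and every vector is a difference of two vectors of the sector.\<close>

lemma has_derivative_within_sector_unique:
  fixes f :: "'e::euclidean_space \<Rightarrow> 'f::real_normed_vector"
  assumes B: "independent B" and S: "openin (top_of_set {x. \<forall>u\<in>B. 0 \<le> u \<bullet> x}) S" and x: "x \<in> S"
    and F: "(f has_derivative F) (at x within S)" and G: "(f has_derivative G) (at x within S)"
  shows "F = G"
proof -
  let ?C = "{x. \<forall>u\<in>B. 0 \<le> u \<bullet> x}"
  have linF: "linear F" and linG: "linear G"
    using F G by (auto dest: has_derivative_linear)
  have on_sector: "F v = G v" if v: "v \<in> ?C" for v
  proof -
    obtain T where T: "open T" "S = ?C \<inter> T"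
      using S unfolding openin_open by blast
    then obtain r where r: "0 < r" "ball x r \<subseteq> T"
      using x open_contains_ball by blast
    \<comment> \<open>The 1 in the denominator takes care of \<open>v = 0\<close>.\<close>
    define d where "d = r / (norm v + 1)"
    have pos: "0 < norm v + 1" using norm_ge_zero[of v] by linarith
    then have d: "0 < d" using r by (simp add: d_def)
    have ray: "x + t *\<^sub>R v \<in> S" if "t \<in> {0..<d}" for t
    proof -
      have "t * norm v \<le> t * (norm v + 1)"
        using that by (intro mult_left_mono) auto
      also have "\<dots> < r"
        using that pos by (simp add: d_def pos_less_divide_eq)
      finally have "x + t *\<^sub>R v \<in> T"
        using r that by (intro subsetD[OF r(2)]) (simp add: dist_norm)
      moreover have "x + t *\<^sub>R v \<in> ?C"
        using x T v that by (auto simp: inner_add_right)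
      ultimately show ?thesis using T by simp
    qed
    have curve: "((\<lambda>t. x + t *\<^sub>R v) has_derivative (\<lambda>t. t *\<^sub>R v)) (at 0 within {0..<d})"
      by (auto intro!: derivative_eq_intros)
    have along: "((\<lambda>t. f (x + t *\<^sub>R v)) has_vector_derivative H v) (at 0 within {0..<d})"
      if H: "(f has_derivative H) (at x within S)" for H
    proof -
      have "(f has_derivative H) (at (x + 0 *\<^sub>R v) within (\<lambda>t. x + t *\<^sub>R v) ` {0..<d})"
        using H ray by (auto intro: has_derivative_subset)
      then have "((\<lambda>t. f (x + t *\<^sub>R v)) has_derivative (\<lambda>t. H (t *\<^sub>R v))) (at 0 within {0..<d})"
        by (rule has_derivative_in_compose[OF curve])
      then show ?thesis
        using linear_scale[OF has_derivative_linear[OF H]] by (simp add: has_vector_derivative_def)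
    qed
    show ?thesis
    proof (rule vector_derivative_unique_within[OF _ along[OF F] along[OF G]])
      \<comment> \<open>The ray gives only a one-sided derivative; it is still unique, as 0 is a
        limit point of the half-open interval.\<close>
      have "0 islimpt {0..<d}"
        using d islimpt_Ico[of 0 d 0] by simp
      then show "at 0 within {0..<d} \<noteq> bot"
        by (simp add: trivial_limit_within)
    qed
  qed
  \<comment> \<open>Independence of \<open>B\<close> provides a linear functional equal to 1 on
    every normal; the vector representing it points into the interior of the sector.\<close>
  obtain \<rho> :: "'e \<Rightarrow> real" where \<rho>: "linear \<rho>" "\<And>u. u \<in> B \<Longrightarrow> \<rho> u = 1"
    using linear_independent_extend[OF B, of "\<lambda>_. 1"] by blast
  define v\<^sub>0 where "v\<^sub>0 = adjoint \<rho> 1"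
  have v\<^sub>0: "u \<bullet> v\<^sub>0 = 1" if "u \<in> B" for u
    using that \<rho> by (simp add: v\<^sub>0_def adjoint_works)
  have fin: "finite B" using B by (rule independent_imp_finite)
  show ?thesis
  proof
    fix w
    \<comment> \<open>\<open>s\<close> bounds \<open>\<bar>u \<bullet> w\<bar>\<close> for all
      normals, so adding \<open>s\<close> times the interior direction moves \<open>w\<close> into
      the sector.\<close>
    define s where "s = (\<Sum>u\<in>B. \<bar>u \<bullet> w\<bar>)"
    have s: "\<bar>u \<bullet> w\<bar> \<le> s" if "u \<in> B" for u
      unfolding s_def using fin that by (intro member_le_sum) auto
    have "s *\<^sub>R v\<^sub>0 \<in> ?C"
      by (auto simp: v\<^sub>0 s_def sum_nonneg)
    moreover have "w + s *\<^sub>R v\<^sub>0 \<in> ?C"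
      using s by (fastforce simp: v\<^sub>0 inner_add_right abs_le_iff)
    ultimately have "F (w + s *\<^sub>R v\<^sub>0) - F (s *\<^sub>R v\<^sub>0) = G (w + s *\<^sub>R v\<^sub>0) - G (s *\<^sub>R v\<^sub>0)"
      by (simp only: on_sector)
    then show "F w = G w"
      by (simp add: linear_add[OF linF] linear_add[OF linG])
  qed
qed

lemma chart_inv_chart:
  assumes "is_chart X \<phi>" "q \<in> fst \<phi>"
  shows "chart_inv \<phi> (snd \<phi> q) = q"
proof -
  have "inj_on (snd \<phi>) (topspace (subtopology X (fst \<phi>)))"
    using assms unfolding is_chart_def by (blast dest: homeomorphic_imp_injective_map)
  moreover have "topspace (subtopology X (fst \<phi>)) = fst \<phi>"
    using assms openin_subset by (auto simp: is_chart_def)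
  ultimately show ?thesis
    using assms by (simp add: chart_inv_def)
qed

text \<open>Composites of transitions live on multiple overlaps. Their chart images are again
  relatively open in a sector, as uniqueness of derivatives requires.\<close>

lemma chart_image_open_in_sector:
  assumes \<phi>: "is_chart X \<phi>" and U: "openin X U" "U \<subseteq> fst \<phi>"
  obtains B where "independent B" "openin (top_of_set {x. \<forall>u\<in>B. 0 \<le> u \<bullet> x}) (snd \<phi> ` U)"
proof -
  obtain B where B: "independent B" "openin (top_of_set {x. \<forall>u\<in>B. 0 \<le> u \<bullet> x}) (snd \<phi> ` fst \<phi>)"
    using \<phi> unfolding is_chart_def by blast
  have "openin (subtopology X (fst \<phi>)) U"
    using U openin_subset_topspace_eq by (auto simp: openin_subtopology)
  then have "openin (top_of_set (snd \<phi> ` fst \<phi>)) (snd \<phi> ` U)"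
    using \<phi> homeomorphic_map_openness_eq unfolding is_chart_def by blast
  then show ?thesis
    using B openin_trans that by blast
qed

lemma chart_derivative_unique:
  assumes "is_chart X \<phi>" "openin X U" "U \<subseteq> fst \<phi>" "p \<in> U"
    and "(f has_derivative F) (at (snd \<phi> p) within snd \<phi> ` U)"
    and "(f has_derivative G) (at (snd \<phi> p) within snd \<phi> ` U)"
  shows "F = G"
proof -
  obtain B where "independent B" "openin (top_of_set {x. \<forall>u\<in>B. 0 \<le> u \<bullet> x}) (snd \<phi> ` U)"
    by (rule chart_image_open_in_sector[OF assms(1-3)])
  then show ?thesis
    by (rule has_derivative_within_sector_unique[OF _ _ imageI[OF assms(4)] assms(5,6)])
qed

section \<open>Jacobians and tangent vectors\<close>

lemma tangent_spaceI:
  assumes "\<And>\<phi> \<psi>. \<phi> \<in> charts_at M p \<Longrightarrow> \<psi> \<in> charts_at M p \<Longrightarrow> X \<psi> = jac \<phi> \<psi> p (X \<phi>)"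
    and "\<And>\<phi>. \<phi> \<notin> charts_at M p \<Longrightarrow> X \<phi> = 0"
  shows "X \<in> tangent_space M p"
  using assms unfolding tangent_space_def by blast

lemma tangent_spaceD:
  assumes "X \<in> tangent_space M p"
  shows "\<phi> \<in> charts_at M p \<Longrightarrow> \<psi> \<in> charts_at M p \<Longrightarrow> X \<psi> = jac \<phi> \<psi> p (X \<phi>)"
    and "\<phi> \<notin> charts_at M p \<Longrightarrow> X \<phi> = 0"
  using assms unfolding tangent_space_def by blast+

context
  fixes M :: "('a, 'n::finite) rmanifold"
  assumes M: "oriented_manifold M"
begin

lemma charts_atD:
  assumes "\<phi> \<in> charts_at M p"
  shows "\<phi> \<in> atlas M" "is_chart (pts M) \<phi>" "openin (pts M) (fst \<phi>)" "p \<in> fst \<phi>"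
  using assms M by (auto simp: charts_at_def oriented_manifold_def is_chart_def)

lemma charts_at_nonempty:
  assumes "p \<in> topspace (pts M)"
  obtains \<phi> where "\<phi> \<in> charts_at M p"
  using assms M unfolding oriented_manifold_def charts_at_def by blast

lemma has_derivative_jac:
  assumes "\<phi> \<in> charts_at M p" "\<psi> \<in> charts_at M p"
  shows "(transition \<phi> \<psi> has_derivative jac \<phi> \<psi> p) (at (snd \<phi> p) within overlap \<phi> \<psi>)"
proof -
  have "smooth_on (overlap \<phi> \<psi>) (transition \<phi> \<psi>)"
    using M assms by (auto simp: oriented_manifold_def charts_at_def)
  moreover have "snd \<phi> p \<in> overlap \<phi> \<psi>"
    using assms by (auto simp: overlap_def charts_at_def)
  ultimately show ?thesis
    unfolding jac_def by (simp add: smooth_on_imp_differentiable flip: frechet_derivative_works)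
qed

lemma linear_jac:
  assumes "\<phi> \<in> charts_at M p" "\<psi> \<in> charts_at M p"
  shows "linear (jac \<phi> \<psi> p)"
  using has_derivative_jac[OF assms] by (rule has_derivative_linear)

text \<open>\<open>frechet_derivative\<close> is a choice among the derivatives within the overlap;
  uniqueness forces it to be the derivative of the identity.\<close>

lemma jac_self:
  assumes \<phi>: "\<phi> \<in> charts_at M p"
  shows "jac \<phi> \<phi> p = (\<lambda>x. x)"
proof (rule chart_derivative_unique[OF charts_atD(2,3)[OF \<phi>] order_refl charts_atD(4)[OF \<phi>]])
  show "(transition \<phi> \<phi> has_derivative jac \<phi> \<phi> p) (at (snd \<phi> p) within snd \<phi> ` fst \<phi>)"
    using has_derivative_jac[OF \<phi> \<phi>] by (simp add: overlap_def)
  show "(transition \<phi> \<phi> has_derivative (\<lambda>x. x)) (at (snd \<phi> p) within snd \<phi> ` fst \<phi>)"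
    by (rule has_derivative_transform[of _ _ _ "\<lambda>x. x"])
      (use charts_atD[OF \<phi>] in \<open>auto simp: transition_def chart_inv_chart\<close>)
qed

text \<open>Chain rule on the triple overlap. \<open>jac \<phi> \<theta> p\<close> is a derivative
  within a possibly larger set, hence also within the triple overlap, where uniqueness identifies
  the two.\<close>

lemma jac_jac:
  assumes \<phi>: "\<phi> \<in> charts_at M p" and \<psi>: "\<psi> \<in> charts_at M p" and \<theta>: "\<theta> \<in> charts_at M p"
  shows "jac \<psi> \<theta> p (jac \<phi> \<psi> p u) = jac \<phi> \<theta> p u"
proof -
  let ?U = "fst \<phi> \<inter> fst \<psi> \<inter> fst \<theta>"
  note chart = charts_atD(2)[OF \<phi>] charts_atD(2)[OF \<psi>]
  have inv_\<phi>: "chart_inv \<phi> (snd \<phi> q) = q" if "q \<in> fst \<phi>" for q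
    using chart_inv_chart[OF chart(1) that] .
  have inv_\<psi>: "chart_inv \<psi> (snd \<psi> q) = q" if "q \<in> fst \<psi>" for q
    using chart_inv_chart[OF chart(2) that] .
  have p: "p \<in> ?U"
    using charts_atD(4) \<phi> \<psi> \<theta> by blast
  have "(\<lambda>u. jac \<psi> \<theta> p (jac \<phi> \<psi> p u)) = jac \<phi> \<theta> p"
  proof (rule chart_derivative_unique[OF chart(1) _ _ p])
    show "openin (pts M) ?U"
      by (intro openin_Int charts_atD(3)[OF \<phi>] charts_atD(3)[OF \<psi>] charts_atD(3)[OF \<theta>])
    show "(transition \<phi> \<theta> has_derivative jac \<phi> \<theta> p) (at (snd \<phi> p) within snd \<phi> ` ?U)"
      by (rule has_derivative_subset[OF has_derivative_jac[OF \<phi> \<theta>]]) (auto simp: overlap_def)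
    have inner: "(transition \<phi> \<psi> has_derivative jac \<phi> \<psi> p) (at (snd \<phi> p) within snd \<phi> ` ?U)"
      by (rule has_derivative_subset[OF has_derivative_jac[OF \<phi> \<psi>]]) (auto simp: overlap_def)
    have "transition \<phi> \<psi> (snd \<phi> p) = snd \<psi> p"
      using p by (simp add: transition_def inv_\<phi>)
    moreover have "transition \<phi> \<psi> ` snd \<phi> ` ?U \<subseteq> overlap \<psi> \<theta>"
      by (auto simp: transition_def inv_\<phi> overlap_def)
    ultimately have outer: "(transition \<psi> \<theta> has_derivative jac \<psi> \<theta> p)
        (at (transition \<phi> \<psi> (snd \<phi> p)) within transition \<phi> \<psi> ` snd \<phi> ` ?U)"
      using has_derivative_subset[OF has_derivative_jac[OF \<psi> \<theta>]] by simp
    show "(transition \<phi> \<theta> has_derivative (\<lambda>u. jac \<psi> \<theta> p (jac \<phi> \<psi> p u))) (at (snd \<phi> p) within snd \<phi> ` ?U)"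
      by (rule has_derivative_transform[OF _ _ has_derivative_in_compose[OF inner outer]])
        (use p in \<open>auto simp: transition_def inv_\<phi> inv_\<psi>\<close>)
  qed blast
  then show ?thesis by (rule fun_cong)
qed

lemma tvec_space_tangent_space: "tvec_space (tangent_space M p)"
proof
  show "(\<lambda>_. 0) \<in> tangent_space M p"
    by (rule tangent_spaceI) (simp_all add: linear_0[OF linear_jac])
  show "(\<lambda>\<phi>. c *\<^sub>R X \<phi> + Y \<phi>) \<in> tangent_space M p"
    if X: "X \<in> tangent_space M p" and Y: "Y \<in> tangent_space M p" for X Y c
  proof (rule tangent_spaceI)
    fix \<phi> \<psi> assume \<phi>: "\<phi> \<in> charts_at M p" and \<psi>: "\<psi> \<in> charts_at M p"
    show "c *\<^sub>R X \<psi> + Y \<psi> = jac \<phi> \<psi> p (c *\<^sub>R X \<phi> + Y \<phi>)"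
      unfolding tangent_spaceD(1)[OF X \<phi> \<psi>] tangent_spaceD(1)[OF Y \<phi> \<psi>]
      using linear_jac[OF \<phi> \<psi>] by (simp add: linear_add linear_scale)
  qed (simp add: tangent_spaceD(2)[OF X] tangent_spaceD(2)[OF Y])
qed

lemma tangent_space_eq_0I:
  assumes \<phi>: "\<phi> \<in> charts_at M p" and X: "X \<in> tangent_space M p" and zero: "X \<phi> = 0"
  shows "X = (\<lambda>_. 0)"
proof
  fix \<psi>
  show "X \<psi> = 0"
  proof (cases "\<psi> \<in> charts_at M p")
    case True
    then show ?thesis
      unfolding tangent_spaceD(1)[OF X \<phi> True] zero by (rule linear_0[OF linear_jac[OF \<phi>]])
  next
    case False
    then show ?thesis by (rule tangent_spaceD(2)[OF X])
  qed
qed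

text \<open>The cocycle condition makes the transported components compatible, so evaluation of
  tangent vectors at a chart is onto.\<close>

lemma tvec_of_mem:
  assumes "\<phi> \<in> charts_at M p"
  shows "tvec_of M \<phi> p u \<in> tangent_space M p" "tvec_of M \<phi> p u \<phi> = u"
  using assms by (auto intro!: tangent_spaceI simp: tvec_of_def jac_jac jac_self)

end


section \<open>Orthonormal frames\<close>

text \<open>The chart \<open>\<kappa>\<close> serves to compare \<open>V\<close> with the coordinate space: evaluation at \<open>\<kappa>\<close> is a linear
  isomorphism.\<close>

locale metric_tvec_space = tvec_space V for V :: "('a, 'n::finite) tvec set" +
  fixes g :: "('a, 'n) tvec \<Rightarrow> ('a, 'n) tvec \<Rightarrow> real" and \<kappa> :: "('a, 'n) chart"
  assumes g_lincomb: "X \<in> V \<Longrightarrow> Y \<in> V \<Longrightarrow> Z \<in> V \<Longrightarrow>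
      g (\<lambda>\<phi>. c *\<^sub>R X \<phi> + Y \<phi>) Z = c * g X Z + g Y Z"
    and g_sym: "X \<in> V \<Longrightarrow> Y \<in> V \<Longrightarrow> g X Y = g Y X"
    and g_pos: "X \<in> V \<Longrightarrow> X \<noteq> (\<lambda>_. 0) \<Longrightarrow> 0 < g X X"
    and \<kappa>_inj: "X \<in> V \<Longrightarrow> X \<kappa> = 0 \<Longrightarrow> X = (\<lambda>_. 0)"
    and \<kappa>_surj: "\<exists>X\<in>V. X \<kappa> = u"
begin

definition orthonormal :: "nat \<Rightarrow> (nat \<Rightarrow> ('a, 'n) tvec) \<Rightarrow> bool" where
  "orthonormal m e \<longleftrightarrow> (\<forall>i<m. e i \<in> V) \<and> (\<forall>i<m. \<forall>j<m. g (e i) (e j) = (if i = j then 1 else 0))"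

lemma g_zero:
  assumes "Z \<in> V"
  shows "g (\<lambda>_. 0) Z = 0"
  using g_lincomb[OF zero_mem zero_mem assms, of 1] by simp

lemma g_scale:
  assumes "X \<in> V" "Z \<in> V"
  shows "g (\<lambda>\<phi>. c *\<^sub>R X \<phi>) Z = c * g X Z"
  using g_lincomb[OF assms(1) zero_mem assms(2), of c] by (simp add: g_zero assms)

lemma scale_mem: "X \<in> V \<Longrightarrow> (\<lambda>\<phi>. c *\<^sub>R X \<phi>) \<in> V"
  using lincomb_mem[OF _ zero_mem, of X c] by simp

lemma g_sum:
  fixes m :: nat
  assumes "\<And>j. j < m \<Longrightarrow> Y j \<in> V" "Z \<in> V"
  shows "g (\<lambda>\<phi>. \<Sum>j<m. c j *\<^sub>R Y j \<phi>) Z = (\<Sum>j<m. c j * g (Y j) Z)"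
  using assms
proof (induction m)
  case 0
  then show ?case by (simp add: g_zero)
next
  case (Suc m)
  then show ?case
    using g_lincomb[of "Y m" "\<lambda>\<phi>. \<Sum>j<m. c j *\<^sub>R Y j \<phi>" Z "c m"] sum_mem[of m Y c]
    by (simp add: add.commute)
qed

lemma g_orthonormal_sum:
  assumes "orthonormal m e" "i < m"
  shows "g (\<lambda>\<phi>. \<Sum>j<m. c j *\<^sub>R e j \<phi>) (e i) = c i"
proof -
  have "g (\<lambda>\<phi>. \<Sum>j<m. c j *\<^sub>R e j \<phi>) (e i) = (\<Sum>j<m. c j * g (e j) (e i))"
    using assms by (intro g_sum) (auto simp: orthonormal_def)
  also have "\<dots> = (\<Sum>j<m. if j = i then c j else 0)"
    using assms by (intro sum.cong) (auto simp: orthonormal_def)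
  finally show ?thesis using assms by simp
qed

text \<open>A Gram-Schmidt step. Dimensions are counted in the coordinates at
  \<open>\<kappa>\<close>, because \<open>V\<close> itself is only a set of functions on
  charts.\<close>

lemma orthonormal_extend:
  assumes e: "orthonormal m e" and m: "m < CARD('n)"
  obtains X where "orthonormal (Suc m) (e(m := X))"
proof -
  let ?S = "span ((\<lambda>j. e j \<kappa>) ` {..<m})"
  have "dim ?S \<le> card ((\<lambda>j. e j \<kappa>) ` {..<m})"
    by (intro dim_le_card) auto
  also have "\<dots> \<le> m" using card_image_le[of "{..<m}" "\<lambda>j. e j \<kappa>"] by simp
  finally have "dim ?S < dim (UNIV :: (real ^ 'n) set)" using m by simp
  then have "?S \<noteq> UNIV" by (metis less_irrefl)
  then obtain u where u: "u \<notin> ?S" by blast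
  obtain Y where Y: "Y \<in> V" "Y \<kappa> = u" using \<kappa>_surj by blast
  define Z where "Z = (\<lambda>\<phi>. \<Sum>j<m. g Y (e j) *\<^sub>R e j \<phi>)"
  define X where "X = (\<lambda>\<phi>. (-1) *\<^sub>R Z \<phi> + Y \<phi>)"
  have mem: "e i \<in> V" if "i < m" for i using e that by (simp add: orthonormal_def)
  have Z: "Z \<in> V" unfolding Z_def by (intro sum_mem mem)
  have X: "X \<in> V" unfolding X_def by (intro lincomb_mem Z Y)
  have perp: "g X (e i) = 0" if "i < m" for i
    using g_lincomb[OF Z Y(1) mem[OF that], of "-1"] g_orthonormal_sum[OF e that] by (simp add: X_def Z_def)
  have "Z \<kappa> \<in> ?S"
    unfolding Z_def by (intro span_sum span_scale span_base) auto
  \<comment> \<open>Otherwise \<open>u\<close> would equal \<open>Z \<kappa>\<close> and lie in the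
    span.\<close>
  then have "X \<kappa> \<noteq> 0"
    using u Y by (auto simp: X_def)
  then have "X \<noteq> (\<lambda>_. 0)" by auto
  then have q: "0 < g X X" by (rule g_pos[OF X])
  define N where "N = (\<lambda>\<phi>. (1 / sqrt (g X X)) *\<^sub>R X \<phi>)"
  have N: "N \<in> V" unfolding N_def by (rule scale_mem[OF X])
  have gN: "g N W = g X W / sqrt (g X X)" if "W \<in> V" for W
    unfolding N_def using g_scale[OF X that, of "1 / sqrt (g X X)"] by simp
  have "g N N = g N X / sqrt (g X X)"
    using gN[OF N] g_sym[OF X N] by simp
  then have "g N N = 1"
    using q by (simp add: gN[OF X] real_div_sqrt)
  moreover have "g N (e i) = 0" "g (e i) N = 0" if "i < m" for i
    using gN[OF mem[OF that]] perp[OF that] g_sym[OF N mem[OF that]] by simp_all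
  ultimately have "orthonormal (Suc m) (e(m := N))"
    using e N by (auto simp: orthonormal_def less_Suc_eq)
  then show ?thesis by (rule that)
qed

lemma orthonormal_exists:
  assumes "m \<le> CARD('n)"
  shows "\<exists>e. orthonormal m e"
  using assms
proof (induction m)
  case 0
  show ?case by (rule exI[of _ undefined]) (simp add: orthonormal_def)
next
  case (Suc m)
  then show ?case using orthonormal_extend by (metis Suc_leD Suc_le_lessD)
qed

text \<open>Columns are indexed by \<open>'n\<close> and the frame by numbers, hence the translation
  through \<open>\<nu>\<close>.\<close>

lemma frame_matrix_mult:
  assumes \<nu>: "bij_betw \<nu> (UNIV :: 'n set) {..<CARD('n)}"
  shows "(\<chi> r c. e (\<nu> c) \<kappa> $ r) *v y = (\<Sum>j<CARD('n). (y $ inv_into UNIV \<nu> j) *\<^sub>R e j \<kappa>)"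
proof -
  have "(\<Sum>j<CARD('n). (y $ inv_into UNIV \<nu> j) *\<^sub>R e j \<kappa>) = (\<Sum>c\<in>UNIV. (y $ c) *\<^sub>R e (\<nu> c) \<kappa>)"
    using bij_betw_imp_inj_on[OF \<nu>] by (subst sum.reindex_bij_betw[OF \<nu>, symmetric]) simp
  then show ?thesis
    by (simp add: vec_eq_iff matrix_vector_mult_def mult.commute)
qed

text \<open>A kernel vector gives a combination of the frame that vanishes at
  \<open>\<kappa>\<close> and hence everywhere; pairing with the frame recovers its coefficients,
  which are therefore 0.\<close>

lemma det_frame_nonzero:
  assumes \<nu>: "bij_betw \<nu> (UNIV :: 'n set) {..<CARD('n)}" and e: "orthonormal (CARD('n)) e"
  shows "det (\<chi> r c. e (\<nu> c) \<kappa> $ r) \<noteq> 0"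
proof -
  let ?A = "\<chi> r c. e (\<nu> c) \<kappa> $ r"
  have "y = 0" if "?A *v y = 0" for y
  proof -
    define Z where "Z = (\<lambda>\<phi>. \<Sum>j<CARD('n). (y $ inv_into UNIV \<nu> j) *\<^sub>R e j \<phi>)"
    have "Z \<in> V"
      unfolding Z_def using e by (intro sum_mem) (simp add: orthonormal_def)
    moreover have "Z \<kappa> = 0"
      using that unfolding frame_matrix_mult[OF \<nu>] by (simp add: Z_def)
    ultimately have "Z = (\<lambda>_. 0)" by (rule \<kappa>_inj)
    moreover have "g Z (e j) = y $ inv_into UNIV \<nu> j" if "j < CARD('n)" for j
      unfolding Z_def by (rule g_orthonormal_sum[OF e that])
    moreover have "\<nu> c < CARD('n)" for c
      using bij_betwE[OF \<nu>] by blast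
    moreover have "inv_into UNIV \<nu> (\<nu> c) = c" for c
      using bij_betw_imp_inj_on[OF \<nu>] by simp
    ultimately have "y $ c = 0" for c
      using g_zero e unfolding orthonormal_def by metis
    then show ?thesis by (simp add: vec_eq_iff)
  qed
  then have "\<exists>B. B ** ?A = mat 1"
    unfolding matrix_left_invertible_ker by blast
  then show ?thesis
    by (simp add: invertible_left_inverse flip: invertible_det_nz)
qed

text \<open>Invertibility of the frame matrix yields coefficients that are right at
  \<open>\<kappa>\<close>; injectivity of evaluation carries this to all charts, and pairing with
  the frame identifies them.\<close>

lemma orthonormal_expansion:
  assumes \<nu>: "bij_betw \<nu> (UNIV :: 'n set) {..<CARD('n)}" and e: "orthonormal (CARD('n)) e" and X: "X \<in> V"
  shows "X = (\<lambda>\<phi>. \<Sum>j<CARD('n). g X (e j) *\<^sub>R e j \<phi>)"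
proof -
  let ?A = "\<chi> r c. e (\<nu> c) \<kappa> $ r"
  have "invertible ?A"
    using det_frame_nonzero[OF \<nu> e] by (simp add: invertible_det_nz)
  then obtain B where "?A ** B = mat 1" unfolding invertible_def by blast
  then have "?A *v (B *v X \<kappa>) = X \<kappa>"
    by (simp add: matrix_vector_mul_assoc)
  then obtain y where y: "?A *v y = X \<kappa>" by blast
  define Z where "Z = (\<lambda>\<phi>. \<Sum>j<CARD('n). (y $ inv_into UNIV \<nu> j) *\<^sub>R e j \<phi>)"
  have Z: "Z \<in> V"
    unfolding Z_def using e by (intro sum_mem) (simp add: orthonormal_def)
  have "(\<lambda>\<phi>. (-1) *\<^sub>R Z \<phi> + X \<phi>) = (\<lambda>_. 0)"
    using y unfolding frame_matrix_mult[OF \<nu>]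
    by (intro \<kappa>_inj lincomb_mem Z X) (simp add: Z_def)
  then have "X = Z" by (auto simp: fun_eq_iff)
  moreover have "g Z (e j) = y $ inv_into UNIV \<nu> j" if "j < CARD('n)" for j
    unfolding Z_def by (rule g_orthonormal_sum[OF e that])
  ultimately show ?thesis by (simp add: Z_def)
qed

lemma oriented_orthonormal_exists:
  assumes \<nu>: "bij_betw \<nu> (UNIV :: 'n set) {..<CARD('n)}"
  shows "\<exists>e. orthonormal (CARD('n)) e \<and> 0 < det (\<chi> r c. e (\<nu> c) \<kappa> $ r)"
proof -
  obtain e where e: "orthonormal (CARD('n)) e" using orthonormal_exists by blast
  let ?A = "\<lambda>e. \<chi> r c. e (\<nu> c) \<kappa> $ r"
  consider "0 < det (?A e)" | "det (?A e) < 0"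
    using det_frame_nonzero[OF \<nu> e] by linarith
  then show ?thesis
  proof cases
    case 1
    then show ?thesis using e by blast
  next
    case 2
    \<comment> \<open>Reversing the first vector keeps orthonormality and changes the orientation;
      there is a first vector because \<open>'n\<close> is nonempty.\<close>
    let ?e' = "e(0 := \<lambda>\<phi>. (-1) *\<^sub>R e 0 \<phi>)"
    have "0 < CARD('n)" by simp
    then have e0: "e 0 \<in> V" using e by (simp add: orthonormal_def)
    have neg: "g (\<lambda>\<phi>. (-1) *\<^sub>R e 0 \<phi>) W = - g (e 0) W" "g W (\<lambda>\<phi>. (-1) *\<^sub>R e 0 \<phi>) = - g W (e 0)"
      if "W \<in> V" for W
      using g_scale[OF e0 that, of "-1"] g_sym[OF that e0] g_sym[OF that scale_mem[OF e0, of "-1"]]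
      by simp_all
    have e': "orthonormal (CARD('n)) ?e'"
      using e neg neg(1)[OF scale_mem[OF e0, of "-1"]] neg(2)[OF e0] scale_mem[OF e0, of "-1"]
      unfolding orthonormal_def by (auto simp del: scaleR_minus_left scaleR_minus1_left)
    define c\<^sub>0 where "c\<^sub>0 = inv_into UNIV \<nu> 0"
    have "0 \<in> \<nu> ` UNIV" using bij_betw_imp_surj_on[OF \<nu>] by simp
    then have c\<^sub>0: "\<nu> c\<^sub>0 = 0" unfolding c\<^sub>0_def by (rule f_inv_into_f)
    then have c0: "\<nu> c = 0 \<longleftrightarrow> c = c\<^sub>0" for c
      using bij_betw_imp_inj_on[OF \<nu>] by (metis injD)
    have "transpose (?A ?e') = (\<chi> c. if c = c\<^sub>0 then (-1) *s e 0 \<kappa> else e (\<nu> c) \<kappa>)"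
      "transpose (?A e) = (\<chi> c. if c = c\<^sub>0 then e 0 \<kappa> else e (\<nu> c) \<kappa>)"
      by (auto simp: vec_eq_iff transpose_def c0 c\<^sub>0)
    then have "det (transpose (?A ?e')) = - det (transpose (?A e))"
      using det_row_mul[of c\<^sub>0 "-1" "\<lambda>_. e 0 \<kappa>" "\<lambda>c. e (\<nu> c) \<kappa>"] by simp
    then have "det (?A ?e') = - det (?A e)"
      by simp
    then show ?thesis using e' 2 by auto
  qed
qed

end

lemma framed_tangent_space:
  assumes M: "oriented_riemannian_manifold M" and p: "p \<in> topspace (pts M)"
  shows "framed_tvec_space (tangent_space M p) (metric M p) (frame M p) (mdim M)"
proof -
  have oriented: "oriented_manifold M" and riemannian: "riemannian_metric M"
    using M by (auto simp: oriented_riemannian_manifold_def)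
  obtain \<kappa> where \<kappa>: "\<kappa> \<in> charts_at M p"
    using charts_at_nonempty[OF oriented p] .
  interpret tvec_space "tangent_space M p"
    by (rule tvec_space_tangent_space[OF oriented])
  interpret metric_tvec_space "tangent_space M p" "metric M p" \<kappa>
  proof
    show "\<exists>X\<in>tangent_space M p. X \<kappa> = u" for u
      using tvec_of_mem[OF oriented \<kappa>] by blast
  qed (use riemannian p tangent_space_eq_0I[OF oriented \<kappa>] in \<open>auto simp: riemannian_metric_def\<close>)
  have num: "bij_betw (num M) UNIV {..<mdim M}"
    using oriented by (simp add: oriented_manifold_def)
  obtain e where e: "orthonormal (mdim M) e" and det: "0 < det (\<chi> r c. e (num M c) \<kappa> $ r)"
    using oriented_orthonormal_exists[OF num] by blast
  \<comment> \<open>Positivity passes from \<open>\<kappa>\<close> to every other chart, since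
    components change by a Jacobian of positive determinant.\<close>
  have "0 < det (\<chi> r c. e (num M c) \<psi> $ r)" if \<psi>: "\<psi> \<in> charts_at M p" for \<psi>
  proof -
    let ?J = "matrix (jac \<kappa> \<psi> p)"
    have "e (num M c) \<psi> = ?J *v e (num M c) \<kappa>" for c
    proof -
      have "e (num M c) \<in> tangent_space M p"
        using e bij_betwE[OF num] by (simp add: orthonormal_def)
      then show ?thesis
        using tangent_spaceD(1)[OF _ \<kappa> \<psi>] matrix_works[of "jac \<kappa> \<psi> p"] linear_jac[OF oriented \<kappa> \<psi>]
        by (metis matrix_vector_mul(2))
    qed
    then have "(\<chi> r c. e (num M c) \<psi> $ r) = ?J ** (\<chi> r c. e (num M c) \<kappa> $ r)"
      by (simp add: vec_eq_iff matrix_matrix_mult_def matrix_vector_mult_def)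
    moreover have "0 < det ?J"
      using oriented \<kappa> \<psi> by (auto simp: oriented_manifold_def charts_at_def)
    ultimately show ?thesis using det by (simp add: det_mul)
  qed
  then have "oriented_orthonormal_frame M p e"
    using e by (simp add: oriented_orthonormal_frame_def orthonormal_def)
  then have "oriented_orthonormal_frame M p (frame M p)"
    unfolding frame_def by (rule someI[of "oriented_orthonormal_frame M p"])
  then have ortho: "orthonormal (mdim M) (frame M p)"
    by (simp add: oriented_orthonormal_frame_def orthonormal_def)
  show "framed_tvec_space (tangent_space M p) (metric M p) (frame M p) (mdim M)"
    by unfold_locales
      (use g_lincomb ortho orthonormal_expansion[OF num ortho] in \<open>auto simp: orthonormal_def\<close>)
qed


section \<open>The Hodge star on the manifold\<close>

text \<open>Without the smoothness condition of \<open>forms\<close>, the range of \<open>hodge\<close> need not be shown to consist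
  of smooth forms.\<close>

definition pointwise_forms :: "('a, 'n::finite) rmanifold \<Rightarrow> nat \<Rightarrow> ('a, 'n) form set" where
  "pointwise_forms M k = {a. (\<forall>p\<in>topspace (pts M). a p \<in> alt_forms k (tangent_space M p)) \<and>
     (\<forall>p. p \<notin> topspace (pts M) \<longrightarrow> a p = (\<lambda>_. 0))}"

lemma forms_subset_pointwise_forms: "forms M k \<subseteq> pointwise_forms M k"
  by (auto simp: forms_def pointwise_forms_def)

lemma hodge_eq_star:
  assumes M: "oriented_riemannian_manifold M" and p: "p \<in> topspace (pts M)"
    and kl: "k + l = mdim M" and b: "b p \<in> alt_forms k (tangent_space M p)"
  shows "hodge M k b p =
    framed_tvec_space.star (tangent_space M p) (metric M p) (frame M p) (mdim M) k (b p)"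
proof -
  interpret framed_tvec_space "tangent_space M p" "metric M p" "frame M p" "mdim M"
    by (rule framed_tangent_space[OF M p])
  have "vol_form M p = vol"
    using p by (simp add: vol_form_def vol_def fun_eq_iff)
  moreover have "form_inner M k p = frame_inner k"
    by (simp add: form_inner_def frame_inner_def fun_eq_iff)
  moreover have "mdim M - k = l" using kl by simp
  ultimately show ?thesis
    using the_star[OF kl b] p by (simp add: hodge_def)
qed

lemma hodge_in_pointwise_forms:
  assumes M: "oriented_riemannian_manifold M" and kl: "k + l = mdim M"
    and b: "b \<in> pointwise_forms M k"
  shows "hodge M k b \<in> pointwise_forms M l"
proof -
  have "hodge M k b p \<in> alt_forms l (tangent_space M p)" if p: "p \<in> topspace (pts M)" for p
  proof -
    interpret framed_tvec_space "tangent_space M p" "metric M p" "frame M p" "mdim M"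
      by (rule framed_tangent_space[OF M p])
    show ?thesis
      using hodge_eq_star[OF M p kl] star_alt[OF kl] b p by (simp add: pointwise_forms_def)
  qed
  then show ?thesis by (simp add: pointwise_forms_def hodge_def)
qed

lemma hodge_cmult:
  assumes M: "oriented_riemannian_manifold M" and kl: "k + l = mdim M"
    and b: "b \<in> pointwise_forms M k"
  shows "hodge M k (\<lambda>p v. c * b p v) = (\<lambda>p v. c * hodge M k b p v)"
proof
  fix p
  show "hodge M k (\<lambda>p v. c * b p v) p = (\<lambda>v. c * hodge M k b p v)"
  proof (cases "p \<in> topspace (pts M)")
    case True
    interpret framed_tvec_space "tangent_space M p" "metric M p" "frame M p" "mdim M"
      by (rule framed_tangent_space[OF M True])
    have bp: "b p \<in> alt_forms k (tangent_space M p)"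
      using b True by (simp add: pointwise_forms_def)
    show ?thesis
      by (simp add: hodge_eq_star[OF M True kl] bp alt_forms_cmult[OF bp] star_cmult)
  qed (simp add: hodge_def)
qed

lemma hodge_hodge:
  assumes M: "oriented_riemannian_manifold M" and kl: "k + l = mdim M"
    and b: "b \<in> pointwise_forms M k"
  shows "hodge M l (hodge M k b) = (\<lambda>p v. (-1) ^ (k * l) * b p v)"
proof
  fix p
  have lk: "l + k = mdim M" using kl by simp
  show "hodge M l (hodge M k b) p = (\<lambda>v. (-1) ^ (k * l) * b p v)"
  proof (cases "p \<in> topspace (pts M)")
    case True
    interpret framed_tvec_space "tangent_space M p" "metric M p" "frame M p" "mdim M"
      by (rule framed_tangent_space[OF M True])
    have bp: "b p \<in> alt_forms k (tangent_space M p)"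
      using b True by (simp add: pointwise_forms_def)
    have "hodge M k b p \<in> alt_forms l (tangent_space M p)"
      using hodge_in_pointwise_forms[OF M kl b] True by (simp add: pointwise_forms_def)
    then show ?thesis
      by (simp add: hodge_eq_star[OF M True lk] hodge_eq_star[OF M True kl, of b] bp star_star[OF kl bp])
  qed (use b in \<open>simp add: hodge_def pointwise_forms_def\<close>)
qed


section \<open>The projection\<close>

text \<open>For a non-integrable integrand both sides are 0, so the factor comes out for arbitrary
  \<open>a\<close>, in particular for the star of a form.\<close>

lemma cell_integral_cmult: "cell_integral M \<sigma> (\<lambda>p v. c * a p v) = c * cell_integral M \<sigma> a"
  unfolding cell_integral_def Let_def
  by (simp only: mult.left_commute[of _ c] integral_mult_right_zero)

lemma reduction_cmult: "reduction M K j (\<lambda>p v. c * a p v) = (\<lambda>s. c * reduction M K j a s)"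
  by (simp add: reduction_def cell_integral_cmult sum_distrib_left algebra_simps fun_eq_iff)

lemma reduction_cochain: "reduction M K j a \<in> cochains K j"
proof -
  have "reduction M K j a (\<lambda>\<sigma>. r * c \<sigma> + d \<sigma>) = r * reduction M K j a c + reduction M K j a d"
    if c: "c \<in> chains K j" and d: "d \<in> chains K j" for c d r
  proof -
    \<comment> \<open>Cancellation may shrink the support of the combined chain, so all three sums
      are taken over the union of the supports.\<close>
    let ?A = "{\<sigma>. c \<sigma> \<noteq> 0} \<union> {\<sigma>. d \<sigma> \<noteq> 0}"
    let ?s = "\<lambda>\<sigma>. r * c \<sigma> + d \<sigma>"
    have fin: "finite ?A" using c d by (simp add: chains_def)
    have sub: "{\<sigma>. ?s \<sigma> \<noteq> 0} \<subseteq> ?A" by auto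
    have "\<sigma> \<in> K \<and> cdim \<sigma> = j" if "?s \<sigma> \<noteq> 0" for \<sigma>
      using c d that by (cases "c \<sigma> = 0") (auto simp: chains_def)
    then have "?s \<in> chains K j"
      using finite_subset[OF sub fin] by (simp add: chains_def)
    moreover have eq: "(\<Sum>\<sigma> | b \<sigma> \<noteq> 0. b \<sigma> * cell_integral M \<sigma> a) = (\<Sum>\<sigma>\<in>?A. b \<sigma> * cell_integral M \<sigma> a)"
      if "{\<sigma>. b \<sigma> \<noteq> 0} \<subseteq> ?A" for b
      using fin that by (intro sum.mono_neutral_left) auto
    moreover have "(\<Sum>\<sigma>\<in>?A. ?s \<sigma> * cell_integral M \<sigma> a) =
        r * (\<Sum>\<sigma>\<in>?A. c \<sigma> * cell_integral M \<sigma> a) + (\<Sum>\<sigma>\<in>?A. d \<sigma> * cell_integral M \<sigma> a)"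
      by (simp add: sum.distrib sum_distrib_left algebra_simps)
    ultimately show ?thesis
      using c d by (simp add: reduction_def eq[OF sub] eq)
  qed
  then show ?thesis by (simp add: cochains_def reduction_def)
qed

lemma projection_in_forms:
  assumes "reconstruction M K I"
  shows "projection M K I j a \<in> forms M j"
  using assms reduction_cochain[of M K j a] unfolding reconstruction_def projection_def by simp

lemma projection_cmult:
  assumes I: "reconstruction M K I"
  shows "projection M K I j (\<lambda>p v. c * a p v) = (\<lambda>p v. c * projection M K I j a p v)"
proof -
  have zero: "(\<lambda>_. 0) \<in> cochains K j" by (simp add: cochains_def)
  have lin: "I j (\<lambda>x. r * s x + t x) = (\<lambda>p v. r * I j s p v + I j t p v)"
    if "s \<in> cochains K j" "t \<in> cochains K j" for r s t
    using I that unfolding reconstruction_def by blast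
  \<comment> \<open>Linearity of \<open>I\<close> is stated for \<open>r * s + t\<close>;
    homogeneity is the case \<open>t = 0\<close> and requires \<open>I\<close> to map 0 to 0, which
    follows from \<open>0 = 1 * 0 + 0\<close>.\<close>
  have "I j (\<lambda>_. 0) = (\<lambda>p v. 0)"
    using lin[OF zero zero, of 1] by (simp add: fun_eq_iff)
  then show ?thesis
    using lin[OF reduction_cochain zero, of c M a] by (simp add: projection_def reduction_cmult)
qed

theorem proposition26:
  fixes M :: "('a, 'n::finite) rmanifold"
    and D D' K :: "('a, 'n) cell set"
    and dual :: "('a, 'n) cell \<Rightarrow> ('a, 'n) cell"
    and I :: "nat \<Rightarrow> ('a, 'n) cochain \<Rightarrow> ('a, 'n) form"
    and k :: nat
    and a :: "('a, 'n) form"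
  assumes "oriented_riemannian_manifold M"
    and "cell_complex M D"
    and "dual_cell_complex M D D' dual"
    and "K = dual ` interior_cells M D"
    and "reconstruction M K I"
    and "k \<le> mdim M"
    and "a \<in> forms M k"
  shows "coprojection M K I (mdim M - k) (hodge M k a) = hodge M k (projection M K I k a) \<and>
         hodge M k (coprojection M K I k a) = projection M K I (mdim M - k) (hodge M k a)"
proof
  note M = assms(1) and I = assms(5)
  define l where "l = mdim M - k"
  have kl: "k + l = mdim M" and lk: "l + k = mdim M" and k: "mdim M - l = k"
    using assms(6) by (auto simp: l_def)
  have a: "a \<in> pointwise_forms M k"
    using assms(7) forms_subset_pointwise_forms by blast
  have proj: "projection M K I j b \<in> pointwise_forms M j" for j b
    using projection_in_forms[OF I] forms_subset_pointwise_forms by blast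
  have sign: "(-1) ^ (k * l) * ((-1) ^ (k * l) * x) = x" for x :: real
    by (simp flip: mult.assoc power_add)
  \<comment> \<open>The double star sits inside the projection here, so its sign is carried out
    through the projection and the outer star by homogeneity.\<close>
  have "coprojection M K I l (hodge M k a) = hodge M k (projection M K I k a)"
    by (simp add: coprojection_def k hodge_hodge[OF M kl a] projection_cmult[OF I]
        hodge_cmult[OF M kl proj] mult.commute[of l k] sign)
  then show "coprojection M K I (mdim M - k) (hodge M k a) = hodge M k (projection M K I k a)"
    by (simp add: l_def)
  \<comment> \<open>Here the double star acts on the projected form, in degree \<open>l\<close>, and
    its sign meets that of the coprojection outside the projection.\<close>
  have "hodge M k (coprojection M K I k a) = projection M K I l (hodge M k a)"
    by (simp add: coprojection_def l_def[symmetric] hodge_cmult[OF M kl hodge_in_pointwise_forms[OF M lk proj]]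
        hodge_hodge[OF M lk proj] mult.commute[of l k] sign)
  then show "hodge M k (coprojection M K I k a) = projection M K I (mdim M - k) (hodge M k a)"
    by (simp add: l_def)
qed

end
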